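(* For every fixed integer $d\ge 2$, $\beta(n,d) = \Omega\!\left((n\log n)^{1/d}\right)$: there is a constant $c=c(d)>0$ such that every set $\mathcal{H}$ of $n$ hyperplanes in $\mathbb{R}^d$ (for $n$ sufficiently large) contains a subset $S\subseteq\mathcal{H}$ with $|S|\ge c(n\log n)^{1/d}$ such that no cell of the arrangement of $\mathcal{H}$ is bounded by hyperplanes of $S$ only.
   Context: For a finite set $\mathcal{H}$ of hyperplanes in $\mathbb{R}^d$, the cells of its arrangement are the connected components of $\mathbb{R}^d\setminus\bigcup_{h\in\mathcal{H}}h$. Let $G(\mathcal{H})$ be the hypergraph with vertex set $\mathcal{H}$ in which, for each cell of the arrangement, the set of hyperplanes containing the facets of that cell forms a hyperedge. A subset $S\subseteq\mathcal{H}$ is independent if it is an independent set of $G(\mathcal{H})$, i.e. no cell of the arrangement has all its facet-supporting hyperplanes in $S$ ("no cell is bounded by hyperplanes of $S$ only"). $\beta(\mathcal{H})$ is the maximum size of an independent subset of $\mathcal{H}$, and $\beta(n,d)=\min\{\beta(\mathcal{H}): \mathcal{H} \text{ a set of } n \text{ hyperplanes in } \mathbb{R}^d\}$. *)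

theory Defs
  imports "HOL-Analysis.Analysis" "HOL-Library.Landau_Symbols"
begin

definition hyperplane :: "'a::euclidean_space set \<Rightarrow> bool" where
  "hyperplane h \<longleftrightarrow> (\<exists>a b. a \<noteq> 0 \<and> h = {x. a \<bullet> x = b})"

definition hyperplane_family :: "nat \<Rightarrow> 'a::euclidean_space set set \<Rightarrow> bool" where
  "hyperplane_family n H \<longleftrightarrow> finite H \<and> card H = n \<and> (\<forall>h\<in>H. hyperplane h)"

definition cells :: "'a::euclidean_space set set \<Rightarrow> 'a set set" where
  "cells H = components (UNIV - \<Union>H)"

text \<open>Cells are open, so the facets of a cell are those of the polyhedron that is its closure.\<close>

definition facet_hyperplanes :: "'a::euclidean_space set set \<Rightarrow> 'a set \<Rightarrow> 'a set set" where
  "facet_hyperplanes H C = {h \<in> H. \<exists>F. F facet_of closure C \<and> F \<subseteq> h}"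

text \<open>A hypergraph is a pair of a vertex set and a set of hyperedges.\<close>

definition arrangement_hypergraph ::
    "'a::euclidean_space set set \<Rightarrow> 'a set set \<times> 'a set set set" where
  "arrangement_hypergraph H = (H, facet_hyperplanes H ` cells H)"

definition independent_in :: "'v set \<times> 'v set set \<Rightarrow> 'v set \<Rightarrow> bool" where
  "independent_in G S \<longleftrightarrow> S \<subseteq> fst G \<and> (\<forall>E\<in>snd G. \<not> E \<subseteq> S)"

text \<open>The maximum is over a nonempty set whenever \<open>H\<close> is a nonempty finite set of hyperplanes.
  For empty \<open>H\<close> the only cell is the whole space, its hyperedge is empty, no set is independent,
  and the value is unspecified.\<close>

definition beta_arr :: "'a::euclidean_space set set \<Rightarrow> nat" where
  "beta_arr H = Max {card S | S. independent_in (arrangement_hypergraph H) S}"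

text \<open>The dimension \<open>d\<close> is carried by the type: \<open>beta TYPE(real ^ 'd) n\<close> is $\beta(n,d)$
  for \<open>d = CARD('d)\<close>.  \<open>Inf\<close> on a nonempty set of naturals is its minimum.\<close>

definition beta :: "'a::euclidean_space itself \<Rightarrow> nat \<Rightarrow> nat" where
  "beta _ n = Inf {beta_arr H | H :: 'a set set. hyperplane_family n H}"

end

theory Submission
  imports Defs
begin

text \<open>Call a cell free if it contains a ray inside the span \<open>U\<close> of the normals.  All cells number
  \<open>O(n ^ dim U)\<close>, free ones only \<open>O(n ^ (dim U - 1))\<close>, and every cell has at least \<open>dim U\<close> facets,
  a non-free one at least \<open>dim U + 1\<close>.  If \<open>dim U = d\<close>, the non-free cells with exactly \<open>d + 1\<close>
  facets are simplices, any \<open>d\<close> of whose facets meet in a vertex of the cell and hence determine it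
  up to \<open>2 ^ d\<close> choices.  So the facets of these simplices form a \<open>(d + 1)\<close>-uniform hypergraph with
  bounded \<open>d\<close>-codegree.

  In a random set of \<open>N = n powr (1/d + \<epsilon>)\<close> hyperplanes there are \<open>o(N)\<close> facet sets of all other kinds,
  and \<open>o(N)\<close> pairs or triples of simplices whose hyperedges form a cycle of length 2 or 3.  After
  deletions, the simplices form a linear triangle-free hypergraph.  There the argument of Shearer and
  Alon applies to a uniformly random independent set \<open>I\<close>: resampling \<open>I\<close> in the star of \<open>v\<close> shows
  that \<open>v \<in> I\<close> has probability exponential in minus the number of hyperedges through \<open>v\<close> that are
  otherwise contained in \<open>I\<close>.  If \<open>I\<close> is small, this number is \<open>O(log n)\<close> with a small constant for
  most \<open>v\<close> by the codegree bound, which makes \<open>I\<close> large after all.\<close>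

section \<open>Random independent sets in linear triangle-free hypergraphs\<close>

text \<open>The threshold is N = n^(1/d): a random N-set contains at most order N^(d+1) / n simplex
  hyperedges, which reaches N exactly there, so deletion alone gives n^(1/d) and the logarithm must
  come from the independent set step. The links inside \<open>I\<close> are bounded for all small
  sets at once: with m^d of order n log n, double counting leaves only a small fraction of all n
  vertices with more than l = \<kappa> log n link sets inside a given m-set. The sample inherits
  this for every m-set by a union bound over n^m sets against a tail exp(-N), which requires m log n
  to be well below N. This and a loss of 16^l are why the sample exceeds n^(1/d) by a small power of
  n; the power stays small so that short cycles remain o(N). On the geometric side every hyperedge
  only has to contain a certificate, so cells are represented by subsets of their facets, trimmed to
  a convenient size. The obstacle there is degenerate position: normals that do not span, and
  unbounded cells with few facets, must be paid for by there being fewer such cells.\<close>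

lemma sum_Pow_disjoint_Un:
  fixes f :: "'a set \<Rightarrow> 'b::comm_monoid_add"
  assumes "A \<inter> B = {}"
  shows "(\<Sum>X\<in>Pow (A \<union> B). f X) = (\<Sum>X\<in>Pow A. \<Sum>Y\<in>Pow B. f (X \<union> Y))"
proof -
  have "bij_betw (\<lambda>(X, Y). X \<union> Y) (Pow A \<times> Pow B) (Pow (A \<union> B))"
    by (rule bij_betw_byWitness[where f' = "\<lambda>Z. (Z \<inter> A, Z \<inter> B)"]) (use assms in auto)
  then show ?thesis
    by (simp add: sum.cartesian_product sum.reindex_bij_betw[symmetric] case_prod_unfold)
qed

text \<open>Members of \<open>F\<close> are disjoint, so the generating function of the number of
  members inside a random subset factors: each member contributes 2^r - 1 + t, every other point of
  \<open>A\<close> a factor 2. The second conjunct controls the truncated subtraction during the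
  induction.\<close>

lemma weighted_subset_sum:
  fixes t :: real
  assumes "finite F" "finite A" "\<And>S. S \<in> F \<Longrightarrow> S \<subseteq> A \<and> card S = r" "pairwise disjnt F"
  shows "(\<Sum>X\<in>Pow A. t ^ card {S \<in> F. S \<subseteq> X}) = 2 ^ (card A - r * card F) * (2 ^ r - 1 + t) ^ card F
    \<and> r * card F \<le> card A"
  using assms
proof (induction F arbitrary: A rule: finite_induct)
  case empty
  then show ?case by (simp add: card_Pow)
next
  case (insert S F)
  define B where "B = A - S"
  have SA: "S \<subseteq> A" and Sr: "card S = r" and finS: "finite S"
    using insert.prems by (auto intro: finite_subset)
  have A: "A = S \<union> B" and SB: "S \<inter> B = {}" using SA by (auto simp: B_def)
  have FB: "T \<subseteq> B \<and> card T = r" if "T \<in> F" for T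
    using insert.prems insert.hyps that by (force simp: B_def pairwise_insert disjnt_def)
  have finB: "finite B" using insert.prems by (simp add: B_def)
  have IH: "(\<Sum>X\<in>Pow B. t ^ card {S \<in> F. S \<subseteq> X}) = 2 ^ (card B - r * card F) * (2 ^ r - 1 + t) ^ card F
    \<and> r * card F \<le> card B"
    by (rule insert.IH) (use finB FB insert.prems in \<open>auto simp: pairwise_insert\<close>)
  have cA: "card A = r + card B" using A SB finS finB Sr by (simp add: card_Un_disjoint)
  have split: "t ^ card {T \<in> insert S F. T \<subseteq> X \<union> Y} = (if X = S then t else 1) * t ^ card {T \<in> F. T \<subseteq> Y}"
    if X: "X \<in> Pow S" and Y: "Y \<in> Pow B" for X Y
  proof -
    have eq: "{T \<in> F. T \<subseteq> X \<union> Y} = {T \<in> F. T \<subseteq> Y}"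
      using FB X SB by blast
    have iff: "S \<subseteq> X \<union> Y \<longleftrightarrow> X = S" using X Y SB by blast
    have "{T \<in> insert S F. T \<subseteq> X \<union> Y} = (if X = S then insert S {T \<in> F. T \<subseteq> Y} else {T \<in> F. T \<subseteq> Y})"
      using eq iff by auto
    then show ?thesis using insert.hyps by auto
  qed
  have "(\<Sum>X\<in>Pow S. (if X = S then t else 1)) = (\<Sum>X\<in>insert S (Pow S - {S}). (if X = S then t else 1))"
    by (rule sum.cong) auto
  also have "\<dots> = t + (\<Sum>X\<in>Pow S - {S}. 1)"
    using finS by (subst sum.insert) (auto intro!: sum.cong)
  also have "\<dots> = 2 ^ r - 1 + t" using finS Sr by (simp add: card_Pow)
  finally have sumS: "(\<Sum>X\<in>Pow S. (if X = S then t else 1)) = 2 ^ r - 1 + t" .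
  have "(\<Sum>X\<in>Pow A. t ^ card {T \<in> insert S F. T \<subseteq> X})
      = (\<Sum>X\<in>Pow S. \<Sum>Y\<in>Pow B. (if X = S then t else 1) * t ^ card {T \<in> F. T \<subseteq> Y})"
    unfolding A sum_Pow_disjoint_Un[OF SB] using split by (intro sum.cong refl) blast
  also have "\<dots> = (2 ^ r - 1 + t) * (\<Sum>Y\<in>Pow B. t ^ card {T \<in> F. T \<subseteq> Y})"
    by (simp add: sum_distrib_left[symmetric] sum_distrib_right[symmetric] sumS)
  finally show ?case using IH cA insert.hyps by simp
qed

definition indep_sets :: "'a set \<Rightarrow> 'a set set \<Rightarrow> 'a set set" where
  "indep_sets W E = {I. I \<subseteq> W \<and> (\<forall>e\<in>E. \<not> e \<subseteq> I)}"

definition link :: "'a set set \<Rightarrow> 'a \<Rightarrow> 'a set set" where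
  "link E v = {e - {v} | e. e \<in> E \<and> v \<in> e}"

definition linear_hypergraph :: "'a set set \<Rightarrow> bool" where
  "linear_hypergraph E \<longleftrightarrow> (\<forall>e\<in>E. \<forall>f\<in>E. e \<noteq> f \<longrightarrow> (\<forall>x y. x \<in> e \<inter> f \<longrightarrow> y \<in> e \<inter> f \<longrightarrow> x = y))"

definition triangle_free :: "'a set set \<Rightarrow> bool" where
  "triangle_free E \<longleftrightarrow> (\<forall>e\<in>E. \<forall>f\<in>E. \<forall>g\<in>E. \<forall>x\<in>e \<inter> f. \<forall>y\<in>f \<inter> g. \<forall>z\<in>e \<inter> g.
     e \<noteq> f \<and> f \<noteq> g \<and> e \<noteq> g \<longrightarrow> x = y \<or> y = z \<or> x = z)"

text \<open>Cauchy-Schwarz in the form that lets inequalities "square at most product", known block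
  by block, be added up.\<close>

lemma cauchy_product_bound:
  fixes a b c :: "'a \<Rightarrow> real"
  assumes "\<And>i. i \<in> I \<Longrightarrow> a i \<ge> 0 \<and> b i \<ge> 0 \<and> c i \<ge> 0 \<and> (a i)\<^sup>2 \<le> b i * c i"
  shows "(\<Sum>i\<in>I. a i)\<^sup>2 \<le> (\<Sum>i\<in>I. b i) * (\<Sum>i\<in>I. c i)"
proof -
  have "(\<Sum>i\<in>I. a i) \<le> (\<Sum>i\<in>I. sqrt (b i) * sqrt (c i))"
    by (rule sum_mono) (metis assms real_le_rsqrt real_sqrt_mult)
  then have "(\<Sum>i\<in>I. a i)\<^sup>2 \<le> (\<Sum>i\<in>I. sqrt (b i) * sqrt (c i))\<^sup>2"
    by (rule power_mono) (use assms in \<open>auto intro: sum_nonneg\<close>)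
  also have "\<dots> \<le> (\<Sum>i\<in>I. (sqrt (b i))\<^sup>2) * (\<Sum>i\<in>I. (sqrt (c i))\<^sup>2)"
    by (rule Cauchy_Schwarz_ineq_sum)
  also have "\<dots> = (\<Sum>i\<in>I. b i) * (\<Sum>i\<in>I. c i)"
    using assms by simp
  finally show ?thesis .
qed

lemma real_card_filter:
  "finite B \<Longrightarrow> real (card {x \<in> B. P x}) = (\<Sum>x\<in>B. if P x then 1 else 0)"
  by (simp add: sum.If_cases Int_def)

lemma sum_card_fibres_filter:
  assumes "finite A"
  shows "(\<Sum>y\<in>f ` A. real (card {x \<in> {x \<in> A. f x = y}. P x})) = real (card {x \<in> A. P x})"
proof -
  have "(\<Sum>y\<in>f ` A. real (card {x \<in> {x \<in> A. f x = y}. P x}))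
      = (\<Sum>y\<in>f ` A. \<Sum>x\<in>{x \<in> A. f x = y}. if P x then 1 else 0)"
    by (intro sum.cong refl real_card_filter) (use assms in simp)
  also have "\<dots> = real (card {x \<in> A. P x})"
    unfolding real_card_filter[OF assms] by (rule sum.image_gen[OF assms, symmetric])
  finally show ?thesis .
qed

lemma sum_card_fibres:
  assumes "finite A"
  shows "(\<Sum>y\<in>f ` A. real (card {x \<in> A. f x = y})) = real (card A)"
  using sum_card_fibres_filter[OF assms, of f "\<lambda>_. True"] by simp

text \<open>With Z(t) the generating function of \<open>weighted_subset_sum\<close>, c = Z(0), and
  Z(1) counts all subsets. Factor by factor, Z(1/4)^2 <= Z(0) Z(1) is (M - 3/4)^2 <= (M - 1) M for M
  = 2^r >= 4; the weight 1/2 would already fail at M = 4. In the resampling, Z(1) counts the choices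
  without \<open>v\<close> and c those with \<open>v\<close>.\<close>

lemma link_weight_inequality:
  assumes "finite A" "finite F" "\<And>S. S \<in> F \<Longrightarrow> S \<subseteq> A \<and> card S = r" "pairwise disjnt F" "r \<ge> 2"
  defines "c \<equiv> real (card {X \<in> Pow A. \<forall>S\<in>F. \<not> S \<subseteq> X})"
  shows "(c + (\<Sum>X\<in>Pow A. (1/4) ^ card {S \<in> F. S \<subseteq> X}))\<^sup>2 \<le> 4 * (real (card (Pow A)) + c) * c"
proof -
  let ?k = "card F" and ?Z = "\<lambda>t::real. (\<Sum>X\<in>Pow A. t ^ card {S \<in> F. S \<subseteq> X})"
  let ?p = "2 ^ (card A - r * ?k) :: real" and ?M = "2 ^ r :: real"
  have Z: "?Z t = ?p * (?M - 1 + t) ^ ?k" for t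
    using weighted_subset_sum[OF assms(2,1,3,4)] by blast
  have M: "?M \<ge> 4" using power_increasing[OF \<open>r \<ge> 2\<close>, of "2::real"] by simp
  have "c = (\<Sum>X\<in>Pow A. if \<forall>S\<in>F. \<not> S \<subseteq> X then 1 else 0)"
    unfolding c_def by (rule real_card_filter) (use assms(1) in simp)
  also have "\<dots> = ?Z 0"
  proof (rule sum.cong[OF refl])
    fix X
    have "card {S \<in> F. S \<subseteq> X} = 0 \<longleftrightarrow> (\<forall>S\<in>F. \<not> S \<subseteq> X)" using assms(2) by auto
    then show "(if \<forall>S\<in>F. \<not> S \<subseteq> X then 1 else 0) = (0::real) ^ card {S \<in> F. S \<subseteq> X}" by auto
  qed
  finally have c: "c = ?p * (?M - 1) ^ ?k" using Z[of 0] by simp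
  have one: "real (card (Pow A)) = ?p * ?M ^ ?k" using Z[of 1] by simp
  have "(?M - 1 + 1/4)\<^sup>2 \<le> (?M - 1) * ?M" using M by (simp add: power2_eq_square algebra_simps)
  then have "((?M - 1 + 1/4)\<^sup>2) ^ ?k \<le> ((?M - 1) * ?M) ^ ?k" by (rule power_mono) simp
  then have "?p\<^sup>2 * ((?M - 1 + 1/4)\<^sup>2) ^ ?k \<le> ?p\<^sup>2 * ((?M - 1) * ?M) ^ ?k"
    by (rule mult_left_mono) simp
  then have key: "(?Z (1/4))\<^sup>2 \<le> c * real (card (Pow A))"
    unfolding Z c one by (simp add: power_mult_distrib power2_eq_square mult_ac power_mult[symmetric])
  have c0: "c \<ge> 0" by (simp add: c_def)
  have "(c + ?Z (1/4))\<^sup>2 \<le> 2 * c\<^sup>2 + 2 * (?Z (1/4))\<^sup>2"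
    using sum_squares_ge_zero[of "c - ?Z (1/4)" 0] by (simp add: power2_eq_square algebra_simps)
  also have "\<dots> \<le> 2 * c\<^sup>2 + 2 * (c * real (card (Pow A)))" using key by simp
  also have "\<dots> \<le> 4 * (real (card (Pow A)) + c) * c"
    using c0 by (simp add: power2_eq_square algebra_simps)
  finally show ?thesis .
qed

text \<open>Condition on the part \<open>J\<close> of a uniformly random independent set outside the star of \<open>v\<close>.\<close>

lemma local_resampling:
  assumes W: "finite W" and E: "\<And>e. e \<in> E \<Longrightarrow> e \<subseteq> W \<and> card e = r + 1" and r: "r \<ge> 2"
    and lin: "linear_hypergraph E" and tri: "triangle_free E" and v: "v \<in> W"
  shows "(\<Sum>I\<in>indep_sets W E. (1/4::real) ^ card {S \<in> link E v. S \<subseteq> I})\<^sup>2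
     \<le> 4 * real (card (indep_sets W E)) * real (card {I \<in> indep_sets W E. v \<in> I})"
proof -
  let ?L = "link E v" and ?Ind = "indep_sets W E"
  let ?w = "\<lambda>I. (1/4::real) ^ card {S \<in> link E v. S \<subseteq> I}"
  define N where "N = \<Union>(link E v)"
  define \<pi> where "\<pi> I = I - N - {v}" for I
  have finE: "finite E" using W E by (intro finite_subset[of E "Pow W"]) auto
  have finL: "finite ?L" using finE by (simp add: link_def)
  have finInd: "finite ?Ind" using W by (auto simp: indep_sets_def intro: finite_subset[of _ "Pow W"])
  have finN: "finite N" and NW: "N \<subseteq> W" using E W by (auto simp: N_def link_def intro: finite_subset)
  have LN: "S \<subseteq> N" if "S \<in> ?L" for S using that by (auto simp: N_def)
  have vN: "v \<notin> N" by (auto simp: N_def link_def)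
  have vS: "v \<notin> S" if "S \<in> ?L" for S using that by (auto simp: link_def)
  have linD: "x = y" if "e \<in> E" "f \<in> E" "e \<noteq> f" "x \<in> e" "x \<in> f" "y \<in> e" "y \<in> f" for e f x y
    using lin that unfolding linear_hypergraph_def by blast
  have linkE: "insert v S \<in> E" if "S \<in> ?L" for S
    using that by (auto simp: link_def insert_absorb)
  have linkc: "card S = r" if "S \<in> ?L" for S
    using that E W by (auto simp: link_def dest: finite_subset)
  have Ldisj: "pairwise disjnt ?L"
  proof (rule pairwiseI)
    fix S T assume ST: "S \<in> ?L" "T \<in> ?L" "S \<noteq> T"
    then have ne: "insert v S \<noteq> insert v T" using vS by (metis insert_ident)
    have "x = v" if "x \<in> S" "x \<in> T" for x
      using linD[OF linkE[OF ST(1)] linkE[OF ST(2)] ne, of x v] that by auto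
    then show "disjnt S T" using vS ST unfolding disjnt_def by blast
  qed
  \<comment> \<open>Vertices of the star that can be added to \<open>J\<close> one at a time. By
    \<open>two\<close> below, an edge avoiding \<open>v\<close> meets \<open>N\<close> at most once,
    so any subset of \<open>av J\<close> can be added simultaneously. Hence \<open>P1\<close>
    (without \<open>v\<close>) is a full cube, and \<open>P2\<close> (with \<open>v\<close>) only
    has to avoid the link sets.\<close>
  define av where "av J = {u \<in> N. \<forall>e\<in>E. u \<in> e \<longrightarrow> v \<notin> e \<longrightarrow> \<not> e - {u} \<subseteq> J}" for J
  define LJ where "LJ J = {S \<in> ?L. S \<subseteq> av J}" for J
  define P1 where "P1 J = (\<lambda>X. J \<union> X) ` Pow (av J)" for J
  define P2 where "P2 J = (\<lambda>X. insert v (J \<union> X)) ` {X \<in> Pow (av J). \<forall>S\<in>LJ J. \<not> S \<subseteq> X}" for J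
  have block: "{I \<in> ?Ind. \<pi> I = J} = P1 J \<union> P2 J" if J: "J \<in> \<pi> ` ?Ind" for J
  proof -
    obtain I0 where I0: "I0 \<in> ?Ind" "J = \<pi> I0" using J by auto
    then have Jind: "J \<in> ?Ind" and JN: "J \<inter> N = {}" and vJ: "v \<notin> J"
      by (auto simp: indep_sets_def \<pi>_def)
    have noe: "\<not> e \<subseteq> insert v (J \<union> X)" if X: "X \<subseteq> av J" and e: "e \<in> E" and ve: "v \<notin> e" for X e
    proof
      assume sub: "e \<subseteq> insert v (J \<union> X)"
      \<comment> \<open>Two such vertices in the same link set would violate linearity; in different
        link sets they would close a triangle through \<open>v\<close>.\<close>
      have two: "u = u'" if u: "u \<in> e \<inter> N" "u' \<in> e \<inter> N" for u u'
      proof (rule ccontr)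
        assume ne: "u \<noteq> u'"
        obtain S S' where S: "S \<in> ?L" "u \<in> S" "S' \<in> ?L" "u' \<in> S'" using u by (auto simp: N_def)
        have ES: "insert v S \<in> E" "insert v S' \<in> E" using linkE S by auto
        have neq: "e \<noteq> insert v S" "e \<noteq> insert v S'" using ve by auto
        show False
        proof (cases "S = S'")
          case True
          then show False using linD[OF ES(1) e, of u u'] neq ne S u by auto
        next
          case False
          then have "insert v S \<noteq> insert v S'" using vS S by (metis insert_ident)
          moreover have "v \<noteq> u" "v \<noteq> u'" using vN u by auto
          moreover have "v \<in> insert v S \<inter> insert v S'" "u' \<in> insert v S' \<inter> e" "u \<in> insert v S \<inter> e"
            using S u by auto
          ultimately show False using tri ES e neq ne unfolding triangle_free_def by metis
        qed
      qed
      have XN: "X \<subseteq> N" using X by (auto simp: av_def)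
      show False
      proof (cases "e \<inter> X = {}")
        case True
        then have "e \<subseteq> J" using sub ve by auto
        then show False using Jind e by (auto simp: indep_sets_def)
      next
        case False
        then obtain u where u: "u \<in> e" "u \<in> X" by auto
        then have "e - {u} \<subseteq> J" using two sub ve XN by blast
        then show False using u X e ve by (auto simp: av_def)
      qed
    qed
    show ?thesis
    proof (intro equalityI subsetI)
      fix I assume "I \<in> {I \<in> ?Ind. \<pi> I = J}"
      then have I: "I \<subseteq> W" "\<And>e. e \<in> E \<Longrightarrow> \<not> e \<subseteq> I" and IJ: "I - N - {v} = J"
        by (auto simp: indep_sets_def \<pi>_def)
      let ?X = "I \<inter> N"
      have X: "?X \<in> Pow (av J)"
      proof -
        have False if u: "u \<in> I" "u \<in> e" "e \<in> E" "e - {u} \<subseteq> J" for u e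
        proof -
          have "e \<subseteq> I" using IJ u by blast
          then show False using I u by blast
        qed
        then show ?thesis unfolding av_def by blast
      qed
      show "I \<in> P1 J \<union> P2 J"
      proof (cases "v \<in> I")
        case True
        have "\<not> S \<subseteq> ?X" if "S \<in> LJ J" for S
          using I(2)[of "insert v S"] linkE that True by (auto simp: LJ_def)
        moreover have "I = insert v (J \<union> ?X)" using IJ True by blast
        ultimately show ?thesis using X unfolding P2_def by blast
      next
        case False
        then have "I = J \<union> ?X" using IJ by blast
        then show ?thesis using X unfolding P1_def by blast
      qed
    next
      fix I assume "I \<in> P1 J \<union> P2 J"
      then consider (1) X where "I = J \<union> X" "X \<subseteq> av J"
        | (2) X where "I = insert v (J \<union> X)" "X \<subseteq> av J" "\<forall>S\<in>LJ J. \<not> S \<subseteq> X"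
        unfolding P1_def P2_def by blast
      then show "I \<in> {I \<in> ?Ind. \<pi> I = J}"
      proof cases
        case 1
        have XN: "X \<subseteq> N" using 1 by (auto simp: av_def)
        have "\<not> e \<subseteq> I" if e: "e \<in> E" for e
        proof (cases "v \<in> e")
          case True then show ?thesis using 1 vJ XN vN by blast
        next
          case False then show ?thesis using noe[OF 1(2) e False] 1 by auto
        qed
        moreover have "I \<subseteq> W" using 1 XN NW Jind by (auto simp: indep_sets_def)
        moreover have "\<pi> I = J" unfolding \<pi>_def using 1 XN JN vJ by blast
        ultimately show ?thesis by (auto simp: indep_sets_def)
      next
        case 2
        have XN: "X \<subseteq> N" using 2 by (auto simp: av_def)
        have "\<not> e \<subseteq> I" if e: "e \<in> E" for e
        proof (cases "v \<in> e")
          case True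
          show ?thesis
          proof
            assume eI: "e \<subseteq> I"
            have S: "e - {v} \<in> ?L" using True e by (auto simp: link_def)
            then have "e - {v} \<subseteq> N" by (rule LN)
            then have "e - {v} \<subseteq> X" using eI 2 JN by blast
            moreover from this have "e - {v} \<in> LJ J" using S 2(2) unfolding LJ_def by blast
            ultimately show False using 2(3) by blast
          qed
        next
          case False then show ?thesis using noe[OF 2(2) e False] 2 by auto
        qed
        moreover have "I \<subseteq> W" using 2 XN NW Jind v by (auto simp: indep_sets_def)
        moreover have "\<pi> I = J" unfolding \<pi>_def using 2 XN JN vJ by blast
        ultimately show ?thesis by (auto simp: indep_sets_def)
      qed
    qed
  qed
  let ?B = "\<lambda>J. {I \<in> ?Ind. \<pi> I = J}"
  have ineq: "(\<Sum>I\<in>?B J. ?w I)\<^sup>2 \<le> (4 * real (card (?B J))) * real (card {I \<in> ?B J. v \<in> I})"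
    if J: "J \<in> \<pi> ` ?Ind" for J
  proof -
    have JN: "J \<inter> N = {}" and vJ: "v \<notin> J" using J by (auto simp: \<pi>_def)
    have avN: "av J \<subseteq> N" by (auto simp: av_def)
    have finav: "finite (av J)" using avN finN finite_subset by blast
    let ?Q = "{X \<in> Pow (av J). \<forall>S\<in>LJ J. \<not> S \<subseteq> X}"
    have inj1: "inj_on (\<lambda>X. J \<union> X) (Pow (av J))"
    proof (rule inj_onI)
      fix X Y assume "X \<in> Pow (av J)" "Y \<in> Pow (av J)" "J \<union> X = J \<union> Y"
      moreover from this have "J \<inter> X = {}" "J \<inter> Y = {}" using JN avN by auto
      ultimately show "X = Y" by blast
    qed
    have inj2: "inj_on (\<lambda>X. insert v (J \<union> X)) ?Q"
    proof (rule inj_onI)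
      fix X Y assume XY: "X \<in> ?Q" "Y \<in> ?Q" "insert v (J \<union> X) = insert v (J \<union> Y)"
      then have "insert v J \<inter> X = {}" "insert v J \<inter> Y = {}" using JN avN vN by auto
      then show "X = Y" using XY(3) by blast
    qed
    have disj: "P1 J \<inter> P2 J = {}" using vJ avN vN unfolding P1_def P2_def by blast
    have fin: "finite (P1 J)" "finite (P2 J)" using finav by (auto simp: P1_def P2_def)
    have vP: "{I \<in> ?B J. v \<in> I} = P2 J"
    proof -
      have "\<forall>I\<in>P1 J. v \<notin> I" using vJ avN vN unfolding P1_def by blast
      moreover have "\<forall>I\<in>P2 J. v \<in> I" unfolding P2_def by blast
      ultimately have "{I \<in> P1 J \<union> P2 J. v \<in> I} = P2 J" by blast
      then show ?thesis by (simp only: block[OF J])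
    qed
    have c2: "card (P2 J) = card ?Q" unfolding P2_def by (rule card_image[OF inj2])
    have c1: "card (P1 J) = card (Pow (av J))" unfolding P1_def by (rule card_image[OF inj1])
    have LJ': "S \<in> LJ J \<longleftrightarrow> S \<in> ?L \<and> S \<subseteq> av J" for S by (simp add: LJ_def)
    have w1: "?w (J \<union> X) = (1/4) ^ card {S \<in> LJ J. S \<subseteq> X}" if X: "X \<subseteq> av J" for X
    proof -
      have "S \<subseteq> J \<union> X \<longleftrightarrow> S \<subseteq> X" if "S \<in> ?L" for S
        using JN LN[OF that] by blast
      then have "{S \<in> ?L. S \<subseteq> J \<union> X} = {S \<in> LJ J. S \<subseteq> X}"
        using X LJ' by (auto intro: order_trans)
      then show ?thesis by simp
    qed
    \<comment> \<open>Here \<open>v\<close> is already chosen, so a link set inside would complete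
      an edge; the weight is trivial on this half of the block.\<close>
    have w2: "?w (insert v (J \<union> X)) = 1" if X: "X \<in> ?Q" for X
    proof -
      have "\<not> S \<subseteq> insert v (J \<union> X)" if "S \<in> ?L" for S
      proof
        assume "S \<subseteq> insert v (J \<union> X)"
        then have "S \<subseteq> X" using JN LN[OF that] vS[OF that] by blast
        moreover from this have "S \<in> LJ J" using X that LJ' by auto
        ultimately show False using X by blast
      qed
      then have "{S \<in> ?L. S \<subseteq> insert v (J \<union> X)} = {}" by blast
      then show ?thesis by (metis card.empty power_0)
    qed
    have s1: "(\<Sum>I\<in>P1 J. ?w I) = (\<Sum>X\<in>Pow (av J). (1/4) ^ card {S \<in> LJ J. S \<subseteq> X})"
      unfolding P1_def sum.reindex[OF inj1] by (rule sum.cong) (use w1 in auto)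
    have s2: "(\<Sum>I\<in>P2 J. ?w I) = real (card ?Q)"
      unfolding P2_def sum.reindex[OF inj2] using w2 by (simp add: o_def)
    have "(\<Sum>I\<in>?B J. ?w I) = real (card ?Q) + (\<Sum>X\<in>Pow (av J). (1/4) ^ card {S \<in> LJ J. S \<subseteq> X})"
      by (simp only: block[OF J] sum.union_disjoint[OF fin disj] s1 s2 add.commute)
    moreover have "real (card (?B J)) = real (card (Pow (av J))) + real (card ?Q)"
      by (simp only: block[OF J] card_Un_disjoint[OF fin disj] c1 c2 of_nat_add)
    moreover have "(real (card ?Q) + (\<Sum>X\<in>Pow (av J). (1/4) ^ card {S \<in> LJ J. S \<subseteq> X}))\<^sup>2
        \<le> 4 * (real (card (Pow (av J))) + real (card ?Q)) * real (card ?Q)"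
      by (rule link_weight_inequality[OF finav _ _ _ r])
         (use finL linkc Ldisj in \<open>auto simp: LJ_def pairwise_def\<close>)
    ultimately show ?thesis by (simp only: vP c2)
  qed
  \<comment> \<open>The blocks partition the independent sets by their part outside the star;
    Cauchy-Schwarz adds up the block inequalities.\<close>
  have "(\<Sum>I\<in>?Ind. ?w I)\<^sup>2 = (\<Sum>J\<in>\<pi> ` ?Ind. \<Sum>I\<in>?B J. ?w I)\<^sup>2"
    by (rule arg_cong[OF sum.image_gen[OF finInd]])
  also have "\<dots> \<le> (\<Sum>J\<in>\<pi> ` ?Ind. 4 * real (card (?B J))) * (\<Sum>J\<in>\<pi> ` ?Ind. real (card {I \<in> ?B J. v \<in> I}))"
  proof (rule cauchy_product_bound, intro conjI)
    fix J assume J: "J \<in> \<pi> ` ?Ind"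
    show "0 \<le> (\<Sum>I\<in>?B J. ?w I)" by (rule sum_nonneg) simp
    show "0 \<le> 4 * real (card (?B J))" "0 \<le> real (card {I \<in> ?B J. v \<in> I})" by simp_all
    show "(\<Sum>I\<in>?B J. ?w I)\<^sup>2 \<le> (4 * real (card (?B J))) * real (card {I \<in> ?B J. v \<in> I})"
      by (rule ineq[OF J])
  qed
  also have "\<dots> = (4 * (\<Sum>J\<in>\<pi> ` ?Ind. real (card (?B J)))) * real (card {I \<in> ?Ind. v \<in> I})"
    by (simp only: sum_distrib_left sum_card_fibres_filter[OF finInd])
  also have "\<dots> = 4 * real (card ?Ind) * real (card {I \<in> ?Ind. v \<in> I})"
    by (simp only: sum_card_fibres[OF finInd])
  finally show ?thesis .
qed

text \<open>Average \<open>local_resampling\<close> over \<open>v\<close>: by \<open>few\<close>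
  each independent set has total weight at least p (1/4)^l, and Cauchy-Schwarz over \<open>W\<close>
  bounds the square of the mean weight by 4 |W| times the mean size of an independent set. The 16 is
  4 squared.\<close>

lemma large_independent_set_linear:
  fixes p :: real
  assumes W: "finite W" and E: "\<And>e. e \<in> E \<Longrightarrow> e \<subseteq> W \<and> card e = r + 1" and r: "r \<ge> 2"
    and lin: "linear_hypergraph E" and tri: "triangle_free E"
    and few: "\<And>I. I \<in> indep_sets W E \<Longrightarrow> p \<le> real (card {v \<in> W. card {S \<in> link E v. S \<subseteq> I} \<le> l})"
    and p: "p \<ge> 0"
  shows "\<exists>I\<in>indep_sets W E. p\<^sup>2 * (1/16) ^ l \<le> 4 * real (card W) * real (card I)"
proof (rule ccontr)
  let ?Ind = "indep_sets W E"
  let ?w = "\<lambda>v I. (1/4::real) ^ card {S \<in> link E v. S \<subseteq> I}"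
  assume "\<not> ?thesis"
  then have small: "4 * real (card W) * real (card I) < p\<^sup>2 * (1/16) ^ l" if "I \<in> ?Ind" for I
    using that by force
  have finInd: "finite ?Ind" using W by (auto simp: indep_sets_def intro: finite_subset[of _ "Pow W"])
  have "{} \<notin> E" using E r by fastforce
  then have "{} \<in> ?Ind" by (auto simp: indep_sets_def)
  then have pos: "card ?Ind > 0" using finInd by (auto simp: card_gt_0_iff)
  have lower: "p * (1/4) ^ l \<le> (\<Sum>v\<in>W. ?w v I)" if I: "I \<in> ?Ind" for I
  proof -
    let ?G = "{v \<in> W. card {S \<in> link E v. S \<subseteq> I} \<le> l}"
    have "p * (1/4) ^ l \<le> real (card ?G) * (1/4) ^ l" using few[OF I] by (intro mult_right_mono) auto
    also have "\<dots> = (\<Sum>v\<in>?G. (1/4) ^ l)" by simp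
    also have "\<dots> \<le> (\<Sum>v\<in>?G. ?w v I)" by (rule sum_mono) (auto intro: power_decreasing)
    also have "\<dots> \<le> (\<Sum>v\<in>W. ?w v I)" by (rule sum_mono2) (use W in auto)
    finally show ?thesis .
  qed
  have "(\<Sum>v\<in>W. real (card {I \<in> ?Ind. v \<in> I})) = (\<Sum>v\<in>W. \<Sum>I\<in>?Ind. if v \<in> I then 1 else 0)"
    by (intro sum.cong refl real_card_filter finInd)
  also have "\<dots> = (\<Sum>I\<in>?Ind. \<Sum>v\<in>W. if v \<in> I then 1 else 0)" by (rule sum.swap)
  also have "\<dots> = (\<Sum>I\<in>?Ind. real (card I))"
  proof (rule sum.cong[OF refl])
    fix I assume "I \<in> ?Ind"
    then have "W \<inter> I = I" by (auto simp: indep_sets_def)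
    then show "(\<Sum>v\<in>W. if v \<in> I then 1 else 0) = real (card I)" using W by (simp add: sum.If_cases Int_def)
  qed
  finally have swap: "(\<Sum>v\<in>W. real (card {I \<in> ?Ind. v \<in> I})) = (\<Sum>I\<in>?Ind. real (card I))" .
  have "real (card ?Ind) * (p * (1/4) ^ l) \<le> (\<Sum>I\<in>?Ind. \<Sum>v\<in>W. ?w v I)"
    using sum_mono[of ?Ind "\<lambda>_. p * (1/4) ^ l", OF lower] by simp
  also have "\<dots> = (\<Sum>v\<in>W. \<Sum>I\<in>?Ind. ?w v I)" by (rule sum.swap)
  finally have "(real (card ?Ind) * (p * (1/4) ^ l))\<^sup>2 \<le> (\<Sum>v\<in>W. \<Sum>I\<in>?Ind. ?w v I)\<^sup>2"
    by (rule power_mono) (use p in auto)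
  also have "\<dots> \<le> (\<Sum>v\<in>W. 4 * real (card ?Ind)) * (\<Sum>v\<in>W. real (card {I \<in> ?Ind. v \<in> I}))"
  proof (rule cauchy_product_bound, intro conjI)
    fix v assume v: "v \<in> W"
    show "0 \<le> (\<Sum>I\<in>?Ind. ?w v I)" by (rule sum_nonneg) simp
    show "(\<Sum>I\<in>?Ind. ?w v I)\<^sup>2 \<le> 4 * real (card ?Ind) * real (card {I \<in> ?Ind. v \<in> I})"
      by (rule local_resampling[OF W E r lin tri v])
  qed simp_all
  finally have "(real (card ?Ind) * (p * (1/4) ^ l))\<^sup>2
      \<le> real (card ?Ind) * (\<Sum>I\<in>?Ind. 4 * real (card W) * real (card I))"
    unfolding swap by (simp add: sum_distrib_left mult_ac)
  also have "\<dots> < real (card ?Ind) * (\<Sum>I\<in>?Ind. p\<^sup>2 * (1/16) ^ l)"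
    using pos finInd by (intro mult_strict_left_mono sum_strict_mono small) auto
  also have "\<dots> = (real (card ?Ind) * (p * (1/4) ^ l))\<^sup>2"
  proof -
    have "((1/4::real) ^ l)\<^sup>2 = (1/16) ^ l" by (simp add: power2_eq_square power_mult_distrib[symmetric])
    then show ?thesis by (simp add: power_mult_distrib power2_eq_square)
  qed
  finally show False by simp
qed

section \<open>Hypergraphs with bounded codegree\<close>

lemma binomial_diff_le:
  assumes "j \<le> N" "N \<le> n"
  shows "real ((n - j) choose (N - j)) \<le> (real N / real n) ^ j * real (n choose N)"
  using assms
proof (induction j)
  case 0
  then show ?case by simp
next
  case (Suc j)
  let ?b = "real ((n - Suc j) choose (N - Suc j))"
  have pos: "N - j > 0" "n - j > 0" "n > 0" using Suc.prems by auto
  have "(N - j) * ((n - j) choose (N - j)) = (n - j) * ((n - Suc j) choose (N - Suc j))"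
    using times_binomial_minus1_eq[OF pos(1), of "n - j"] by simp
  then have "real (N - j) * real ((n - j) choose (N - j)) = real (n - j) * ?b"
    by (metis of_nat_mult)
  then have b: "?b = real (N - j) / real (n - j) * real ((n - j) choose (N - j))"
    using pos by (simp add: field_simps)
  have "real j * real N \<le> real j * real n" using Suc.prems by (intro mult_left_mono) auto
  then have "(real N - real j) * real n \<le> real N * (real n - real j)"
    by (simp add: algebra_simps)
  then have "real (N - j) / real (n - j) \<le> real N / real n"
    using Suc.prems pos by (simp add: divide_simps of_nat_diff mult_ac)
  then have "?b \<le> real N / real n * ((real N / real n) ^ j * real (n choose N))"
    unfolding b by (rule mult_mono) (use Suc in auto)
  then show ?case by simp
qed

text \<open>Removing \<open>b\<close> embeds these sets into the (N - |b|)-subsets of the rest. The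
  quotient of the binomials is a product of factors (N - i) / (n - i) <= N / n, so sampling with
  fixed size is dominated by independent sampling at rate N / n.\<close>

lemma card_supersets_le:
  assumes V: "finite V" "card V = n" and "N \<le> n" and b: "b \<subseteq> V"
  shows "real (card {W. W \<subseteq> V \<and> card W = N \<and> b \<subseteq> W}) \<le> (real N / real n) ^ card b * real (n choose N)"
proof (cases "card b \<le> N")
  case True
  have finb: "finite b" using b V finite_subset by blast
  let ?A = "{W. W \<subseteq> V \<and> card W = N \<and> b \<subseteq> W}" and ?B = "{Y. Y \<subseteq> V - b \<and> card Y = N - card b}"
  have "(\<lambda>W. W - b) ` ?A \<subseteq> ?B" using finb by (auto simp: card_Diff_subset)
  moreover have "inj_on (\<lambda>W. W - b) ?A" by (rule inj_onI) blast
  ultimately have "card ?A \<le> card ?B"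
    using V by (intro card_inj_on_le[of "\<lambda>W. W - b"]) auto
  also have "card ?B = (n - card b) choose (N - card b)"
    using V b finb by (subst n_subsets) (auto simp: card_Diff_subset)
  finally show ?thesis using binomial_diff_le[OF True \<open>N \<le> n\<close>] by linarith
next
  case False
  have "{W. W \<subseteq> V \<and> card W = N \<and> b \<subseteq> W} = {}"
    using False V by (auto dest: finite_subset card_mono)
  then show ?thesis by (metis card.empty divide_nonneg_nonneg mult_nonneg_nonneg of_nat_0 of_nat_0_le_iff zero_le_power)
qed

lemma sum_card_swap:
  assumes "finite A" "finite B"
  shows "(\<Sum>x\<in>A. real (card {y \<in> B. R x y})) = (\<Sum>y\<in>B. real (card {x \<in> A. R x y}))"
proof -
  have "(\<Sum>x\<in>A. real (card {y \<in> B. R x y})) = (\<Sum>x\<in>A. \<Sum>y\<in>B. if R x y then 1 else 0)"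
    using assms by (simp add: sum.If_cases Int_def)
  also have "\<dots> = (\<Sum>y\<in>B. \<Sum>x\<in>A. if R x y then 1 else 0)" by (rule sum.swap)
  also have "\<dots> = (\<Sum>y\<in>B. real (card {x \<in> A. R x y}))"
    using assms by (simp add: sum.If_cases Int_def)
  finally show ?thesis .
qed

text \<open>First moment method for a uniformly random \<open>N\<close>-element subset of \<open>V\<close>.\<close>

lemma sparse_sample_exists:
  fixes s :: real
  assumes V: "finite V" "card V = n" and N: "N \<le> n" and s: "s > 0"
    and B: "B \<subseteq> Pow V" and X: "\<X> \<subseteq> Pow V"
    and small: "(\<Sum>b\<in>B. (real N / real n) ^ card b) / s
       + (\<Sum>X\<in>\<X>. real (card X choose h) * (real N / real n) ^ h) < 1"
  obtains W where "W \<subseteq> V" "card W = N" "real (card {b \<in> B. b \<subseteq> W}) < s"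
    "\<And>X. X \<in> \<X> \<Longrightarrow> card (X \<inter> W) < h"
proof -
  define \<Omega> where "\<Omega> = {W. W \<subseteq> V \<and> card W = N}"
  have fin\<Omega>: "finite \<Omega>" using V by (auto simp: \<Omega>_def intro: finite_subset[of _ "Pow V"])
  have card\<Omega>: "card \<Omega> = n choose N" using n_subsets[OF V(1)] V by (simp add: \<Omega>_def)
  have pos: "card \<Omega> > 0" using N by (simp add: card\<Omega>)
  have finB: "finite B" and finX: "finite \<X>" using B X V by (auto intro: finite_subset)
  let ?Y = "\<lambda>X. {Y. Y \<subseteq> X \<and> card Y = h}"
  have finY: "finite (?Y X)" "finite X" if "X \<in> \<X>" for X
    using X V that by (auto intro: finite_subset[of _ "Pow V"] finite_subset[of X V])
  have sup: "real (card {W \<in> \<Omega>. b \<subseteq> W}) \<le> (real N / real n) ^ card b * card \<Omega>" if "b \<subseteq> V" for b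
    using card_supersets_le[OF V N that] by (simp add: \<Omega>_def card\<Omega>[unfolded \<Omega>_def] conj_assoc)
  have "\<exists>W\<in>\<Omega>. real (card {b \<in> B. b \<subseteq> W}) < s \<and> (\<forall>X\<in>\<X>. card (X \<inter> W) < h)"
  proof (rule ccontr)
    assume neg: "\<not> ?thesis"
    \<comment> \<open>A failing \<open>W\<close> contains at least \<open>s\<close> bad sets or some
      \<open>h\<close>-subset of a member of \<open>\<X>\<close>; counting these
      \<open>h\<close>-subsets turns the upper tail into a first moment.\<close>
    have one: "1 \<le> real (card {b \<in> B. b \<subseteq> W}) / s + (\<Sum>X\<in>\<X>. real (card {Y \<in> ?Y X. Y \<subseteq> W}))"
      if W: "W \<in> \<Omega>" for W
    proof (cases "real (card {b \<in> B. b \<subseteq> W}) < s")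
      case True
      then obtain X0 where X0: "X0 \<in> \<X>" "h \<le> card (X0 \<inter> W)" using neg W by force
      then obtain Y where Y: "Y \<subseteq> X0 \<inter> W" "card Y = h"
        by (meson obtain_subset_with_card_n)
      then have "card {Y \<in> ?Y X0. Y \<subseteq> W} \<noteq> 0"
        using finY[OF X0(1)] by auto
      then have "1 \<le> real (card {Y \<in> ?Y X0. Y \<subseteq> W})" by linarith
      also have "\<dots> \<le> (\<Sum>X\<in>\<X>. real (card {Y \<in> ?Y X. Y \<subseteq> W}))"
        by (rule member_le_sum) (use X0 finX in auto)
      moreover have "0 \<le> real (card {b \<in> B. b \<subseteq> W}) / s" using s by simp
      ultimately show ?thesis by linarith
    next
      case False
      then have "1 \<le> real (card {b \<in> B. b \<subseteq> W}) / s" using s by simp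
      moreover have "0 \<le> (\<Sum>X\<in>\<X>. real (card {Y \<in> ?Y X. Y \<subseteq> W}))" by (rule sum_nonneg) simp
      ultimately show ?thesis by linarith
    qed
    have "real (card \<Omega>) \<le> (\<Sum>W\<in>\<Omega>. real (card {b \<in> B. b \<subseteq> W}) / s + (\<Sum>X\<in>\<X>. real (card {Y \<in> ?Y X. Y \<subseteq> W})))"
      using sum_mono[of \<Omega> "\<lambda>_. 1", OF one] by simp
    also have "\<dots> = (\<Sum>W\<in>\<Omega>. real (card {b \<in> B. b \<subseteq> W})) / s
        + (\<Sum>X\<in>\<X>. \<Sum>W\<in>\<Omega>. real (card {Y \<in> ?Y X. Y \<subseteq> W}))"
      unfolding sum.distrib sum_divide_distrib by (subst sum.swap) (rule refl)
    also have "\<dots> = (\<Sum>b\<in>B. real (card {W \<in> \<Omega>. b \<subseteq> W})) / s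
        + (\<Sum>X\<in>\<X>. \<Sum>Y\<in>?Y X. real (card {W \<in> \<Omega>. Y \<subseteq> W}))"
      using sum_card_swap[OF fin\<Omega> finB, of "\<lambda>W b. b \<subseteq> W"]
        sum_card_swap[OF fin\<Omega> finY(1), of _ "\<lambda>W b. b \<subseteq> W"] by (simp cong: sum.cong)
    also have "\<dots> \<le> (\<Sum>b\<in>B. (real N / real n) ^ card b * card \<Omega>) / s
        + (\<Sum>X\<in>\<X>. \<Sum>Y\<in>?Y X. (real N / real n) ^ h * card \<Omega>)"
    proof (intro add_mono divide_right_mono sum_mono)
      fix b assume "b \<in> B"
      then show "real (card {W \<in> \<Omega>. b \<subseteq> W}) \<le> (real N / real n) ^ card b * card \<Omega>"
        using sup B by auto
    next
      fix X Y assume "X \<in> \<X>" "Y \<in> ?Y X"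
      then show "real (card {W \<in> \<Omega>. Y \<subseteq> W}) \<le> (real N / real n) ^ h * card \<Omega>"
        using sup[of Y] X by auto
    qed (use s in simp)
    also have "(\<Sum>X\<in>\<X>. \<Sum>Y\<in>?Y X. (real N / real n) ^ h * card \<Omega>)
        = (\<Sum>X\<in>\<X>. real (card X choose h) * ((real N / real n) ^ h * card \<Omega>))"
      by (rule sum.cong) (simp_all add: n_subsets finY)
    also have "(\<Sum>b\<in>B. (real N / real n) ^ card b * card \<Omega>) / s
        + (\<Sum>X\<in>\<X>. real (card X choose h) * ((real N / real n) ^ h * card \<Omega>))
      = card \<Omega> * ((\<Sum>b\<in>B. (real N / real n) ^ card b) / s
       + (\<Sum>X\<in>\<X>. real (card X choose h) * (real N / real n) ^ h))"
      by (simp add: sum_distrib_left sum_divide_distrib distrib_left mult_ac)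
    also have "\<dots> < real (card \<Omega>) * 1" using small pos by (intro mult_strict_left_mono) auto
    finally show False by simp
  qed
  then show ?thesis using that by (auto simp: \<Omega>_def)
qed

text \<open>h^h / h! is one term of the series of exp h, and e <= 3.\<close>

lemma power_le_fact: "real h ^ h \<le> 3 ^ h * fact h"
proof -
  have "(\<Sum>n\<in>{h}. real h ^ n /\<^sub>R fact n) \<le> exp (real h)"
    unfolding exp_def by (rule sum_le_suminf) (use summable_exp_generic[of "real h"] in auto)
  also have "exp (real h) = exp 1 ^ h" using exp_of_nat_mult[of h "1::real"] by simp
  also have "\<dots> \<le> 3 ^ h" by (rule power_mono[OF exp_le]) simp
  finally show ?thesis by (simp add: field_simps)
qed

text \<open>Upper tail bound: the left side dominates the expected number of
  \<open>h\<close>-subsets of an \<open>x\<close>-set in a sample of density \<rho>. It decays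
  exponentially once \<open>h\<close> exceeds the mean by a constant factor above 3.\<close>

lemma binomial_weight_le:
  fixes \<rho> :: real
  assumes "0 \<le> \<rho>" "h > 0"
  shows "real (x choose h) * \<rho> ^ h \<le> (3 * real x * \<rho> / real h) ^ h"
proof -
  have "real (x choose h) * fact h \<le> real x ^ h"
    using binomial_fact_pow[of x h] by (metis of_nat_fact of_nat_le_iff of_nat_mult of_nat_power)
  then have "real (x choose h) * real h ^ h \<le> real (x choose h) * (3 ^ h * fact h)"
    using power_le_fact by (intro mult_left_mono) auto
  also have "\<dots> = 3 ^ h * (real (x choose h) * fact h)" by simp
  also have "\<dots> \<le> 3 ^ h * real x ^ h"
    using \<open>real (x choose h) * fact h \<le> real x ^ h\<close> by (intro mult_left_mono) auto
  finally have "real (x choose h) \<le> (3 * real x) ^ h / real h ^ h"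
    using assms by (simp add: field_simps power_mult_distrib)
  then have "real (x choose h) * \<rho> ^ h \<le> (3 * real x) ^ h / real h ^ h * \<rho> ^ h"
    using assms by (intro mult_right_mono) auto
  then show ?thesis by (simp add: power_mult_distrib power_divide)
qed

lemma card_UN_bound:
  assumes "finite I" "card I \<le> a" "\<And>i. i \<in> I \<Longrightarrow> card (A i) \<le> c"
  shows "card (\<Union>i\<in>I. A i) \<le> a * c"
proof -
  have "card (\<Union>i\<in>I. A i) \<le> (\<Sum>i\<in>I. card (A i))" by (rule card_UN_le[OF assms(1)])
  also have "\<dots> \<le> card I * c" using sum_bounded_above[of I "\<lambda>i. card (A i)" c] assms by simp
  also have "\<dots> \<le> a * c" using assms by simp
  finally show ?thesis .
qed

lemma sum_UN_le:
  fixes f :: "'a \<Rightarrow> real"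
  assumes "finite I" "\<And>i. i \<in> I \<Longrightarrow> finite (A i)" "\<And>x. f x \<ge> 0"
  shows "sum f (\<Union>i\<in>I. A i) \<le> (\<Sum>i\<in>I. sum f (A i))"
  using assms(1,2)
proof (induction I rule: finite_induct)
  case (insert i I)
  have "sum f (A i \<union> (\<Union>i\<in>I. A i)) \<le> sum f (A i) + sum f (\<Union>i\<in>I. A i)"
    using insert.prems insert.hyps assms(3)
    by (subst sum_Un) (auto intro!: sum_nonneg)
  then show ?case using insert by force
qed simp

section \<open>Counting edges, short cycles and blocked vertices under a codegree bound\<close>

definition bounded_codegree :: "nat \<Rightarrow> nat \<Rightarrow> 'a set \<Rightarrow> 'a set set \<Rightarrow> bool" where
  "bounded_codegree r K V E \<longleftrightarrow> (\<forall>e\<in>E. e \<subseteq> V \<and> card e = r + 1)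
     \<and> (\<forall>T. T \<subseteq> V \<and> card T = r \<longrightarrow> card {e \<in> E. T \<subseteq> e} \<le> K)"

text \<open>Light families have expected number \<open>o(N)\<close> of members inside a random set of
  \<open>N = n powr (1/r + \<epsilon>)\<close> vertices, so they can be destroyed by deleting vertices.\<close>

definition light :: "nat \<Rightarrow> nat \<Rightarrow> nat \<Rightarrow> 'a set set \<Rightarrow> bool" where
  "light n r M B \<longleftrightarrow> (\<exists>j k. 1 \<le> j \<and> j \<le> k * r \<and> k \<le> 3 \<and> (\<forall>b\<in>B. card b = j) \<and> card B * n ^ k \<le> M * n ^ j)"

text \<open>At most M n^(j - k) members of size j give an expected number of at most M N^j / n^k <=
  M (N^r / n)^k, by j <= k r. Since N^r >= n, the case k = 3 dominates, and one bound serves all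
  families.\<close>

lemma light_weight:
  assumes "light n r M B" "1 \<le> N" "1 \<le> n" "n \<le> N ^ r"
  shows "(\<Sum>b\<in>B. (real N / real n) ^ card b) \<le> real M * (real N ^ (3 * r) / real n ^ 3)"
proof -
  obtain j k where jk: "j \<le> k * r" "k \<le> 3" "\<forall>b\<in>B. card b = j" "card B * n ^ k \<le> M * n ^ j"
    using assms(1) by (auto simp: light_def)
  have "real (card B) * real n ^ k \<le> real M * real n ^ j"
    using jk(4) by (metis of_nat_le_iff of_nat_mult of_nat_power)
  then have cB: "real (card B) \<le> real M * real n ^ j / real n ^ k"
    using assms by (simp add: field_simps)
  have "(\<Sum>b\<in>B. (real N / real n) ^ card b) = real (card B) * (real N / real n) ^ j"
    using jk by simp
  also have "\<dots> \<le> real M * real n ^ j / real n ^ k * (real N / real n) ^ j"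
    by (rule mult_right_mono[OF cB]) simp
  also have "\<dots> = real M * (real N ^ j / real n ^ k)"
    using assms by (simp add: power_divide)
  also have "\<dots> \<le> real M * (real N ^ (k * r) / real n ^ k)"
    using assms jk by (intro mult_left_mono divide_right_mono power_increasing) auto
  also have "real N ^ (k * r) / real n ^ k = (real N ^ r / real n) ^ k"
    by (simp add: power_divide power_mult[symmetric] mult.commute)
  also have "\<dots> \<le> (real N ^ r / real n) ^ 3"
  proof (rule power_increasing[OF jk(2)])
    have "real n \<le> real N ^ r" using assms(4) by (metis of_nat_le_iff of_nat_power)
    then show "1 \<le> real N ^ r / real n" using assms by simp
  qed
  also have "(real N ^ r / real n) ^ 3 = real N ^ (3 * r) / real n ^ 3"
    by (simp add: power_divide power_mult[symmetric] mult.commute)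
  finally show ?thesis by (simp add: mult_left_mono)
qed

context
  fixes r K n :: nat and V :: "'a set" and E :: "'a set set"
  assumes V: "finite V" "card V = n" and E: "bounded_codegree r K V E" and r: "r \<ge> 2" and n: "n \<ge> 1"
begin

lemma edges: "e \<in> E \<Longrightarrow> e \<subseteq> V" "e \<in> E \<Longrightarrow> card e = r + 1" "e \<in> E \<Longrightarrow> finite e" "finite E"
  using E V by (auto simp: bounded_codegree_def intro: finite_subset[of _ V] finite_subset[of _ "Pow V"])

text \<open>Each vertex by which \<open>T\<close> falls short of \<open>r\<close> costs a factor
  n.\<close>

lemma card_edges_containing:
  assumes "T \<subseteq> V" "card T + i = r"
  shows "card {e \<in> E. T \<subseteq> e} \<le> K * n ^ i"
  using assms
proof (induction i arbitrary: T)
  case 0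
  then show ?case using E by (auto simp: bounded_codegree_def)
next
  case (Suc i)
  have finT: "finite T" using Suc.prems V finite_subset by blast
  have "{e \<in> E. T \<subseteq> e} \<subseteq> (\<Union>x\<in>V - T. {e \<in> E. insert x T \<subseteq> e})"
  proof
    fix e assume e: "e \<in> {e \<in> E. T \<subseteq> e}"
    then have "card T < card e" using Suc.prems edges by auto
    then have "\<not> e \<subseteq> T" using finT card_mono by (metis not_le)
    then obtain x where "x \<in> e" "x \<notin> T" by blast
    then show "e \<in> (\<Union>x\<in>V - T. {e \<in> E. insert x T \<subseteq> e})" using e edges(1) by blast
  qed
  then have "card {e \<in> E. T \<subseteq> e} \<le> card (\<Union>x\<in>V - T. {e \<in> E. insert x T \<subseteq> e})"
    using V edges(4) by (intro card_mono) auto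
  also have "\<dots> \<le> n * (K * n ^ i)"
  proof (rule card_UN_bound)
    show "card (V - T) \<le> n" using V by (metis Diff_subset card_mono)
    fix x assume "x \<in> V - T"
    then show "card {e \<in> E. insert x T \<subseteq> e} \<le> K * n ^ i"
      using Suc.prems finT by (intro Suc.IH) auto
  qed (use V in simp)
  finally show ?case by (simp add: mult_ac)
qed

lemma card_edges: "card E \<le> K * n ^ r"
  using card_edges_containing[of "{}" r] by simp

text \<open>For i >= 2 these are the 2-cycles. Only the union is recorded, since deleting any vertex
  of it destroys the pair.\<close>

definition overlaps :: "nat \<Rightarrow> 'a set set" where
  "overlaps i = {e \<union> f | e f. e \<in> E \<and> f \<in> E \<and> card (e \<inter> f) = i}"

lemma overlaps_subset: "overlaps i \<subseteq> Pow V"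
  using edges(1) by (auto simp: overlaps_def)

text \<open>Choose \<open>e\<close>, an \<open>i\<close>-set \<open>T\<close> inside it, then
  \<open>f\<close> through \<open>T\<close>: order n^(2 r - i) unions on 2 r + 2 - i vertices, so k
  = 2, and i >= 2 is exactly j <= 2 r.\<close>

lemma light_overlaps:
  assumes "2 \<le> i" "i \<le> r"
  shows "light n r (K * 2 ^ (r + 1) * K) (overlaps i)"
proof -
  let ?U = "(\<Union>e\<in>E. \<Union>T\<in>{T. T \<subseteq> e \<and> card T = i}. \<Union>f\<in>{f \<in> E. T \<subseteq> f}. {e \<union> f})"
  have "overlaps i \<subseteq> ?U"
    unfolding overlaps_def by blast
  moreover have "finite ?U" using edges by auto
  ultimately have "card (overlaps i) \<le> card ?U" by (rule card_mono[rotated])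
  also have "\<dots> \<le> (K * n ^ r) * (2 ^ (r + 1) * ((K * n ^ (r - i)) * 1))"
  proof (intro card_UN_bound)
    fix e T assume e: "e \<in> E" and T: "T \<in> {T. T \<subseteq> e \<and> card T = i}"
    then have "T \<subseteq> V" using edges(1) by blast
    then show "card {f \<in> E. T \<subseteq> f} \<le> K * n ^ (r - i)"
      using T assms by (intro card_edges_containing) auto
  next
    fix e assume e: "e \<in> E"
    have "card {T. T \<subseteq> e \<and> card T = i} = (r + 1) choose i"
      using n_subsets[OF edges(3)[OF e]] edges(2)[OF e] by simp
    then show "card {T. T \<subseteq> e \<and> card T = i} \<le> 2 ^ (r + 1)"
      using binomial_le_pow2[of "r + 1" i] by simp
  qed (use edges card_edges in auto)
  also have "\<dots> = K * 2 ^ (r + 1) * K * (n ^ r * n ^ (r - i))" by simp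
  finally have c: "card (overlaps i) \<le> K * 2 ^ (r + 1) * K * (n ^ r * n ^ (r - i))" .
  have "card (overlaps i) * n ^ 2 \<le> K * 2 ^ (r + 1) * K * (n ^ r * n ^ (r - i)) * n ^ 2"
    by (rule mult_right_mono[OF c]) simp
  also have "\<dots> = K * 2 ^ (r + 1) * K * n ^ (r + (r - i) + 2)"
    by (simp only: power_add mult.assoc)
  also have "r + (r - i) + 2 = 2 * r + 2 - i" using assms by simp
  finally have "card (overlaps i) * n ^ 2 \<le> K * 2 ^ (r + 1) * K * n ^ (2 * r + 2 - i)" .
  moreover have "card b = 2 * r + 2 - i" if "b \<in> overlaps i" for b
  proof -
    obtain e f where ef: "e \<in> E" "f \<in> E" "card (e \<inter> f) = i" "b = e \<union> f" using \<open>b \<in> overlaps i\<close> by (auto simp: overlaps_def)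
    then have "card (e \<union> f) + i = (r + 1) + (r + 1)"
      using card_Un_Int[OF edges(3)[OF ef(1)] edges(3)[OF ef(2)]] edges(2) by simp
    then show ?thesis using ef by simp
  qed
  ultimately show ?thesis unfolding light_def using assms
    by (intro exI[of _ "2 * r + 2 - i"] exI[of _ 2]) auto
qed

definition triangles :: "'a set set" where
  "triangles = {e \<union> f \<union> g | e f g x y z. e \<in> E \<and> f \<in> E \<and> g \<in> E \<and> e \<inter> f = {x} \<and> f \<inter> g = {y} \<and> e \<inter> g = {z}
     \<and> x \<noteq> y \<and> y \<noteq> z \<and> x \<noteq> z}"

lemma triangles_subset: "triangles \<subseteq> Pow V"
  using edges(1) by (auto simp: triangles_def)

text \<open>Choose \<open>e\<close> with corners x and z, then \<open>f\<close> through x, a corner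
  y on \<open>f\<close>, and \<open>g\<close> through y and z: order n^(3 r - 3) triangles on 3 r
  vertices, so k = 3 and j = k r without slack.\<close>

lemma light_triangles: "light n r (K ^ 3 * (r + 1) ^ 3) triangles"
proof -
  \<comment> \<open>Drawing y from \<open>f - {z}\<close> keeps {y, z} a two-element set, as the
    bound for \<open>g\<close> requires.\<close>
  let ?U = "(\<Union>e\<in>E. \<Union>x\<in>e. \<Union>z\<in>e. \<Union>f\<in>{f \<in> E. {x} \<subseteq> f}. \<Union>y\<in>f - {z}. \<Union>g\<in>{g \<in> E. {y, z} \<subseteq> g}. {e \<union> f \<union> g})"
  have "triangles \<subseteq> ?U"
  proof
    fix b assume "b \<in> triangles"
    then obtain e f g x y z where b: "b = e \<union> f \<union> g" "e \<in> E" "f \<in> E" "g \<in> E" "e \<inter> f = {x}" "f \<inter> g = {y}"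
      "e \<inter> g = {z}" "y \<noteq> z" by (auto simp: triangles_def)
    then have "x \<in> e" "z \<in> e" "{x} \<subseteq> f" "y \<in> f - {z}" "{y, z} \<subseteq> g" by auto
    then show "b \<in> ?U" unfolding UN_iff using b
      by (intro bexI[of _ e] bexI[of _ x] bexI[of _ z] bexI[of _ f] bexI[of _ y] bexI[of _ g]) simp_all
  qed
  moreover have "finite ?U" using edges by auto
  ultimately have "card triangles \<le> card ?U" by (rule card_mono[rotated])
  also have "\<dots> \<le> (K * n ^ r) * ((r + 1) * ((r + 1) * ((K * n ^ (r - 1)) * ((r + 1) * ((K * n ^ (r - 2)) * 1)))))"
  proof (intro card_UN_bound)
    fix e x assume "e \<in> E" "x \<in> e"
    then show "card {f \<in> E. {x} \<subseteq> f} \<le> K * n ^ (r - 1)"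
      using edges(1) r by (intro card_edges_containing) auto
  next
    fix e x z f y assume "e \<in> E" "z \<in> e" "f \<in> {f \<in> E. {x} \<subseteq> f}" "y \<in> f - {z}"
    then show "card {g \<in> E. {y, z} \<subseteq> g} \<le> K * n ^ (r - 2)"
      using edges(1) r by (intro card_edges_containing) auto
  next
    fix f z x assume "f \<in> {f \<in> E. {x} \<subseteq> f}"
    then show "card (f - {z}) \<le> r + 1" using edges by (metis (lifting) card_Diff1_le mem_Collect_eq)
  qed (use edges card_edges in auto)
  also have "\<dots> = K ^ 3 * (r + 1) ^ 3 * (n ^ r * n ^ (r - 1) * n ^ (r - 2))"
    by (simp only: power3_eq_cube mult_ac mult_1_right)
  finally have c: "card triangles \<le> K ^ 3 * (r + 1) ^ 3 * (n ^ r * n ^ (r - 1) * n ^ (r - 2))" .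
  have "card triangles * n ^ 3 \<le> K ^ 3 * (r + 1) ^ 3 * (n ^ r * n ^ (r - 1) * n ^ (r - 2)) * n ^ 3"
    by (rule mult_right_mono[OF c]) simp
  also have "\<dots> = K ^ 3 * (r + 1) ^ 3 * n ^ (r + (r - 1) + (r - 2) + 3)"
    by (simp only: power_add mult.assoc)
  also have "r + (r - 1) + (r - 2) + 3 = 3 * r" using r by simp
  finally have "card triangles * n ^ 3 \<le> K ^ 3 * (r + 1) ^ 3 * n ^ (3 * r)" .
  moreover have "card b = 3 * r" if "b \<in> triangles" for b
  proof -
    obtain e f g x y z where b: "b = e \<union> f \<union> g" "e \<in> E" "f \<in> E" "g \<in> E" "e \<inter> f = {x}" "f \<inter> g = {y}"
      "e \<inter> g = {z}" "y \<noteq> z" using \<open>b \<in> triangles\<close> by (auto simp: triangles_def)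
    have fin: "finite e" "finite f" "finite g" using b edges by auto
    have "card (e \<union> f) + 1 = (r + 1) + (r + 1)"
      using card_Un_Int[OF fin(1,2)] b edges(2) by simp
    moreover have "(e \<union> f) \<inter> g = {y, z}" using b by blast
    then have "card (e \<union> f \<union> g) + 2 = card (e \<union> f) + (r + 1)"
      using card_Un_Int[of "e \<union> f" g] fin b edges(2) by simp
    ultimately show ?thesis using b by simp
  qed
  ultimately show ?thesis unfolding light_def using r
    by (intro exI[of _ "3 * r"] exI[of _ 3]) auto
qed

text \<open>Computed in the whole of \<open>V\<close>, hence dependent on \<open>I\<close> but not
  on the sample; this is what permits a union bound over all \<open>m\<close>-sets.\<close>

definition blocked :: "nat \<Rightarrow> 'a set \<Rightarrow> 'a set" where
  "blocked l I = {v \<in> V. l < card {T. T \<subseteq> I \<and> card T = r \<and> v \<notin> T \<and> insert v T \<in> E}}"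

text \<open>Double count the pairs (v, T): each of the at most m^r sets \<open>T\<close> extends to
  at most \<open>K\<close> edges.\<close>

lemma card_blocked:
  assumes I: "I \<subseteq> V" "card I = m"
  shows "card (blocked l I) * (l + 1) \<le> K * m ^ r"
proof -
  have finI: "finite I" using I V finite_subset by blast
  let ?T = "{T. T \<subseteq> I \<and> card T = r}" and ?R = "\<lambda>v T. v \<notin> T \<and> insert v T \<in> E"
  have finT: "finite ?T" using finI by simp
  have finb: "finite (blocked l I)" using V by (simp add: blocked_def)
  have Teq: "{T. T \<subseteq> I \<and> card T = r \<and> v \<notin> T \<and> insert v T \<in> E} = {T \<in> ?T. ?R v T}" for v by auto
  have "real (card (blocked l I) * (l + 1)) = (\<Sum>v\<in>blocked l I. real (l + 1))"
    by (simp add: distrib_left)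
  also have "\<dots> \<le> (\<Sum>v\<in>blocked l I. real (card {T \<in> ?T. ?R v T}))"
  proof (rule sum_mono)
    fix v assume "v \<in> blocked l I"
    then have "l + 1 \<le> card {T. T \<subseteq> I \<and> card T = r \<and> v \<notin> T \<and> insert v T \<in> E}"
      by (simp add: blocked_def)
    then show "real (l + 1) \<le> real (card {T \<in> ?T. ?R v T})"
      unfolding Teq of_nat_le_iff .
  qed
  also have "\<dots> = (\<Sum>T\<in>?T. real (card {v \<in> blocked l I. ?R v T}))"
    by (rule sum_card_swap[OF finb finT])
  also have "\<dots> \<le> (\<Sum>T\<in>?T. real K)"
  proof (rule sum_mono)
    fix T assume T: "T \<in> ?T"
    have "inj_on (\<lambda>v. insert v T) {v \<in> blocked l I. ?R v T}" by (rule inj_onI) blast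
    then have "card {v \<in> blocked l I. ?R v T} \<le> card {e \<in> E. T \<subseteq> e}"
      using edges by (intro card_inj_on_le[of "\<lambda>v. insert v T"]) auto
    also have "\<dots> \<le> K" using card_edges_containing[of T 0] T I by auto
    finally show "real (card {v \<in> blocked l I. ?R v T}) \<le> real K" by simp
  qed
  also have "\<dots> = real ((m choose r) * K)" using n_subsets[OF finI] I by simp
  finally have "card (blocked l I) * (l + 1) \<le> (m choose r) * K" by (simp only: of_nat_le_iff)
  also have "m choose r \<le> m ^ r"
  proof -
    have "(m choose r) * 1 \<le> (m choose r) * fact r" by (intro mult_left_mono) simp_all
    then show ?thesis using binomial_fact_pow[of m r] by linarith
  qed
  finally show ?thesis by (simp add: mult.commute)
qed

end

section \<open>The sampling argument and its parameters\<close>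

lemma light_nonempty: "light n r M B \<Longrightarrow> b \<in> B \<Longrightarrow> b \<noteq> {}"
  by (auto simp: light_def)

text \<open>\<open>\<omega>\<close> keeps the expected number of bad sets (both light families,
  2-cycles, triangles) below N / 40; \<open>m\<close> pays for the union bound over
  \<open>m\<close>-sets; \<open>l\<close> makes each blocked set at most a fraction exp(-2) / 6 of
  the vertices; \<open>fin\<close> contradicts the outcome of
  \<open>large_independent_set_linear\<close>. Assuming that no good \<open>S\<close> exists makes
  every independent set of the sample small, so that the union bound covers it.\<close>

lemma independent_set_core:
  fixes V :: "'a set"
  assumes V: "finite V" "card V = n" and E: "bounded_codegree r K V E" and r: "r \<ge> 2"
    and B: "B1 \<subseteq> Pow V" "B2 \<subseteq> Pow V" "light n r K B1" "light n r K B2"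
    and N: "2 \<le> N" "N \<le> n" "n \<le> N ^ r"
    and \<omega>: "40 * real (2 * K + r * (K * 2 ^ (r + 1) * K) + K ^ 3 * (r + 1) ^ 3) * real N ^ (3 * r) \<le> real N * real n ^ 3"
    and m: "m \<le> n" "real m * ln (real n) \<le> real N / 4"
    and l: "6 * real K * real m ^ r \<le> exp (-2) * real (l + 1) * real n"
    and fin: "256 * real m * 16 ^ l < real N"
  shows "\<exists>S\<subseteq>V. (\<forall>e\<in>E \<union> B1 \<union> B2. \<not> e \<subseteq> S) \<and> m \<le> card S"
proof (rule ccontr)
  assume neg: "\<not> ?thesis"
  have n: "n \<ge> 1" "N \<ge> 1" using N by auto
  note ctx = V E r n(1)
  note edges = edges[OF ctx]
  define Ov where "Ov = (\<Union>i\<in>{2..r}. overlaps E i)"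
  define B where "B = B1 \<union> B2 \<union> Ov \<union> triangles E"
  define \<rho> where "\<rho> = real N / real n"
  define wt where "wt A = (\<Sum>b\<in>A. \<rho> ^ card b)" for A :: "'a set set"
  define \<Omega> where "\<Omega> = real N ^ (3 * r) / real n ^ 3"
  have \<rho>: "\<rho> \<ge> 0" by (simp add: \<rho>_def)
  have OV: "Ov \<subseteq> Pow V" unfolding Ov_def using overlaps_subset[OF ctx] by (rule UN_least)
  have BV: "B \<subseteq> Pow V"
    unfolding B_def using B OV triangles_subset[OF ctx] by (intro Un_least)
  have finsub: "finite A" if "A \<subseteq> Pow V" for A using V that by (auto intro: finite_subset)
  have wtU: "wt (A \<union> A') \<le> wt A + wt A'" if "A \<subseteq> Pow V" "A' \<subseteq> Pow V" for A A'
    unfolding wt_def using that \<rho> by (subst sum_Un) (auto intro!: sum_nonneg finsub)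
  have lightw: "wt A \<le> real M * \<Omega>" if "light n r M A" for A M
    using light_weight[OF that n(2,1) N(3)] by (simp add: wt_def \<rho>_def \<Omega>_def)
  have "wt Ov \<le> (\<Sum>i\<in>{2..r}. wt (overlaps E i))"
    unfolding Ov_def wt_def using overlaps_subset[OF ctx] \<rho> by (intro sum_UN_le finsub) auto
  also have "\<dots> \<le> (\<Sum>i\<in>{2..r}. real (K * 2 ^ (r + 1) * K) * \<Omega>)"
    by (intro sum_mono lightw light_overlaps[OF ctx]) auto
  also have "\<dots> \<le> real r * (real (K * 2 ^ (r + 1) * K) * \<Omega>)"
    unfolding sum_constant by (rule mult_right_mono) (auto simp: \<Omega>_def)
  finally have wO: "wt Ov \<le> real (r * (K * 2 ^ (r + 1) * K)) * \<Omega>"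
    by (simp only: of_nat_mult mult.assoc)
  have "wt B \<le> wt (B1 \<union> B2 \<union> Ov) + wt (triangles E)"
    unfolding B_def using B OV triangles_subset[OF ctx] by (intro wtU) auto
  also have "wt (B1 \<union> B2 \<union> Ov) \<le> wt (B1 \<union> B2) + wt Ov"
    using B OV by (intro wtU) auto
  also have "wt (B1 \<union> B2) \<le> wt B1 + wt B2" using B by (intro wtU) auto
  finally have "wt B \<le> wt B1 + wt B2 + wt Ov + wt (triangles E)" by simp
  then have "wt B \<le> real (2 * K + r * (K * 2 ^ (r + 1) * K) + K ^ 3 * (r + 1) ^ 3) * \<Omega>"
    using lightw[OF B(3)] lightw[OF B(4)] wO lightw[OF light_triangles[OF ctx]]
    by (simp add: algebra_simps)
  also have "\<dots> \<le> real N / 40"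
    using \<omega> n by (simp add: \<Omega>_def field_simps)
  finally have wtB: "wt B / (real N / 10) \<le> 1/4" using n by (simp add: field_simps)

  \<comment> \<open>Half of the sample, rounded up: fewer than N / 10 deleted and fewer than h
    blocked vertices leave at least N / 8, as N >= 2.\<close>
  define h where "h = (N + 1) div 2"
  have h: "real N \<le> 2 * real h" "2 * real h \<le> real N + 1" "h > 0"
    using N unfolding h_def by linarith+
  define \<X> where "\<X> = blocked r V E l ` {I. I \<subseteq> V \<and> card I = m}"
  have \<X>V: "\<X> \<subseteq> Pow V" by (auto simp: \<X>_def blocked_def[OF ctx])
  have "card \<X> \<le> n choose m"
    unfolding \<X>_def using card_image_le[of "{I. I \<subseteq> V \<and> card I = m}"] n_subsets[OF V(1)] V by simp
  also have "n choose m \<le> n ^ m" by (rule binomial_le_pow[OF m(1)])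
  finally have c\<X>: "real (card \<X>) \<le> real n ^ m" by (metis of_nat_le_iff of_nat_power)
  have one\<X>: "real (card X choose h) * \<rho> ^ h \<le> exp (-2) ^ h" if X: "X \<in> \<X>" for X
  proof -
    obtain I where I: "I \<subseteq> V" "card I = m" "X = blocked r V E l I" using X by (auto simp: \<X>_def)
    have "real (card X) * real (l + 1) \<le> real K * real m ^ r"
      using card_blocked[OF ctx I(1,2), of l] I(3) by (metis of_nat_le_iff of_nat_mult of_nat_power)
    then have "6 * (real (card X) * real (l + 1)) \<le> 6 * (real K * real m ^ r)"
      by (rule mult_left_mono) simp
    also have "\<dots> \<le> exp (-2) * real (l + 1) * real n" using l by (simp only: mult.assoc)
    finally have "6 * real (card X) * real (l + 1) \<le> exp (-2) * real n * real (l + 1)"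
      by (simp only: mult_ac)
    then have x: "6 * real (card X) \<le> exp (-2) * real n"
      by (rule mult_right_le_imp_le) simp
    have "3 * real (card X) * real N \<le> 3 * real (card X) * (2 * real h)"
      using h by (intro mult_left_mono) auto
    also have "\<dots> = 6 * real (card X) * real h" by simp
    also have "\<dots> \<le> exp (-2) * real n * real h" by (rule mult_right_mono[OF x]) simp
    finally have "3 * real (card X) * \<rho> / real h \<le> exp (-2)"
      using h n by (simp add: \<rho>_def field_simps)
    then have "(3 * real (card X) * \<rho> / real h) ^ h \<le> exp (-2) ^ h"
      using \<rho> by (intro power_mono) auto
    with binomial_weight_le[OF \<rho> h(3), of "card X"] show ?thesis by linarith
  qed
  \<comment> \<open>At most n^m sets against exp(-2 h) each: since 2 h >= N and m ln n <= N / 4, the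
    total is at most exp(-3 N / 4) <= exp(-1).\<close>
  have "(\<Sum>X\<in>\<X>. real (card X choose h) * \<rho> ^ h) \<le> real (card \<X>) * exp (-2) ^ h"
    using sum_mono[OF one\<X>] by simp
  also have "\<dots> \<le> real n ^ m * exp (-2) ^ h" by (rule mult_right_mono[OF c\<X>]) simp
  also have "\<dots> = exp (real m * ln (real n) + real h * (-2))"
    unfolding exp_add exp_of_nat_mult using n by simp
  also have "\<dots> \<le> exp (-1)" unfolding exp_le_cancel_iff using m h N by linarith
  also have "\<dots> \<le> 1 / 2" using exp_ge_add_one_self[of 1] by (simp add: exp_minus field_simps)
  finally have wtX: "(\<Sum>X\<in>\<X>. real (card X choose h) * \<rho> ^ h) \<le> 1 / 2" .

  obtain W where W: "W \<subseteq> V" "card W = N" "real (card {b \<in> B. b \<subseteq> W}) < real N / 10"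
    "\<And>X. X \<in> \<X> \<Longrightarrow> card (X \<inter> W) < h"
  proof (rule sparse_sample_exists[OF V N(2) _ BV \<X>V, of "real N / 10" h])
    show "0 < real N / 10" using n by simp
    show "(\<Sum>b\<in>B. (real N / real n) ^ card b) / (real N / 10)
        + (\<Sum>X\<in>\<X>. real (card X choose h) * (real N / real n) ^ h) < 1"
      using wtB wtX unfolding wt_def \<rho>_def by linarith
  qed blast
  have finW: "finite W" using W V finite_subset by blast
  \<comment> \<open>One vertex of each bad set that survives in \<open>W\<close>; a choice exists
    because lightness includes j >= 1, so bad sets are nonempty.\<close>
  define D where "D = (\<lambda>b. SOME x. x \<in> b) ` {b \<in> B. b \<subseteq> W}"
  have "finite {b \<in> B. b \<subseteq> W}" using finsub[OF BV] by simp
  then have cD: "real (card D) < real N / 10" and finD: "finite D"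
    unfolding D_def using W(3) card_image_le[of "{b \<in> B. b \<subseteq> W}" "\<lambda>b. SOME x. x \<in> b"] by auto
  define W' where "W' = W - D"
  have W'W: "W' \<subseteq> W" and W'V: "W' \<subseteq> V" and finW': "finite W'" using finW W by (auto simp: W'_def)
  have cW': "real (card W') \<ge> real N - real N / 10"
    using diff_card_le_card_Diff[OF finD, of W] cD W(2) unfolding W'_def by linarith
  have noB: "\<not> b \<subseteq> W'" if b: "b \<in> B" for b
  proof
    assume bW: "b \<subseteq> W'"
    have "b \<noteq> {}"
      using b light_nonempty B light_overlaps[OF ctx] light_triangles[OF ctx]
      unfolding B_def Ov_def by (metis UN_iff Un_iff atLeastAtMost_iff)
    then have "(SOME x. x \<in> b) \<in> b" by (simp add: some_in_eq)
    moreover have "(SOME x. x \<in> b) \<in> D" using b bW W'W by (auto simp: D_def)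
    ultimately show False using bW by (auto simp: W'_def)
  qed
  define E' where "E' = {e \<in> E. e \<subseteq> W'}"
  have E': "e \<subseteq> W' \<and> card e = r + 1" if "e \<in> E'" for e using that edges(2) by (auto simp: E'_def)
  have small_int: "card (e \<inter> f) < 2" if ef: "e \<in> E'" "f \<in> E'" "e \<noteq> f" for e f
  proof (rule ccontr)
    assume ge: "\<not> card (e \<inter> f) < 2"
    have EE: "e \<in> E" "f \<in> E" using ef by (auto simp: E'_def)
    have fin: "finite e" "finite f" using edges(3) EE by auto
    have "e \<inter> f \<noteq> e"
      using card_subset_eq[OF fin(2), of e] edges(2) EE ef by auto
    then have "card (e \<inter> f) < card e" using fin by (intro psubset_card_mono) auto
    then have "card (e \<inter> f) \<in> {2..r}" using ge edges(2)[OF EE(1)] by simp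
    moreover have "e \<union> f \<in> overlaps E (card (e \<inter> f))" using EE unfolding overlaps_def[OF ctx] by blast
    ultimately have "e \<union> f \<in> B" unfolding B_def Ov_def by blast
    then show False using noB ef by (auto simp: E'_def)
  qed
  have int_eq: "e \<inter> f = {x}" if ef: "e \<in> E'" "f \<in> E'" "e \<noteq> f" and x: "x \<in> e \<inter> f" for e f x
  proof -
    have fin: "finite (e \<inter> f)" using ef edges(3) by (auto simp: E'_def)
    then have "card (e \<inter> f) > 0" using x by (subst card_gt_0_iff) blast
    then have "card (e \<inter> f) = 1" using small_int[OF ef] by linarith
    then show ?thesis using x by (metis card_1_singletonE singletonD)
  qed
  have lin: "linear_hypergraph E'"
    unfolding linear_hypergraph_def using int_eq by (metis singletonD)
  have tri: "triangle_free E'"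
    unfolding triangle_free_def
  proof (intro ballI impI, rule ccontr)
    fix e f g x y z assume *: "e \<in> E'" "f \<in> E'" "g \<in> E'" "x \<in> e \<inter> f" "y \<in> f \<inter> g" "z \<in> e \<inter> g"
      "e \<noteq> f \<and> f \<noteq> g \<and> e \<noteq> g" "\<not> (x = y \<or> y = z \<or> x = z)"
    have "e \<inter> f = {x}" by (rule int_eq) (use * in simp_all)
    moreover have "f \<inter> g = {y}" by (rule int_eq) (use * in simp_all)
    moreover have "e \<inter> g = {z}" by (rule int_eq) (use * in simp_all)
    moreover have "e \<in> E" "f \<in> E" "g \<in> E" using * by (auto simp: E'_def)
    ultimately have "e \<union> f \<union> g \<in> triangles E" using * unfolding triangles_def[OF ctx] by blast
    then show False using noB[of "e \<union> f \<union> g"] * by (auto simp: B_def E'_def)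
  qed
  have indep: "I \<subseteq> V \<and> (\<forall>e\<in>E \<union> B1 \<union> B2. \<not> e \<subseteq> I)" if I: "I \<in> indep_sets W' E'" for I
  proof -
    have "I \<subseteq> W'" using I by (auto simp: indep_sets_def)
    moreover have "\<not> e \<subseteq> I" if "e \<in> B1 \<union> B2" for e
      using noB[of e] that \<open>I \<subseteq> W'\<close> by (auto simp: B_def)
    moreover have "\<not> e \<subseteq> I" if "e \<in> E" for e
      using I that \<open>I \<subseteq> W'\<close> by (auto simp: indep_sets_def E'_def)
    ultimately show ?thesis using W'V by blast
  qed
  then have small: "card I \<le> m" if "I \<in> indep_sets W' E'" for I
    using neg that by (meson nat_le_linear)
  have few: "real N / 8 \<le> real (card {v \<in> W'. card {S \<in> link E' v. S \<subseteq> I} \<le> l})"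
    if I: "I \<in> indep_sets W' E'" for I
  proof -
    \<comment> \<open>The sample controls blocked sets only for sets of size exactly
      \<open>m\<close>; enlarging \<open>I\<close> to \<open>J\<close> can only add link
      sets.\<close>
    obtain J where J: "I \<subseteq> J" "J \<subseteq> V" "card J = m"
      using exists_subset_between[of I m V] small[OF I] indep[OF I] V m by auto
    let ?X = "blocked r V E l J"
    have finJ: "finite J" using J V finite_subset by blast
    have "W' - ?X \<inter> W \<subseteq> {v \<in> W'. card {S \<in> link E' v. S \<subseteq> I} \<le> l}"
    proof
      fix v assume v: "v \<in> W' - ?X \<inter> W"
      have "{S \<in> link E' v. S \<subseteq> I} \<subseteq> {T. T \<subseteq> J \<and> card T = r \<and> v \<notin> T \<and> insert v T \<in> E}"
      proof
        fix S assume "S \<in> {S \<in> link E' v. S \<subseteq> I}"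
        then obtain e where e: "e \<in> E" "v \<in> e" "S = e - {v}" "S \<subseteq> I" by (auto simp: link_def E'_def)
        then have "card S = r" "insert v S = e" using edges(2) by auto
        then show "S \<in> {T. T \<subseteq> J \<and> card T = r \<and> v \<notin> T \<and> insert v T \<in> E}" using e J by auto
      qed
      then have "card {S \<in> link E' v. S \<subseteq> I} \<le> card {T. T \<subseteq> J \<and> card T = r \<and> v \<notin> T \<and> insert v T \<in> E}"
        using finJ by (intro card_mono) auto
      also have "\<dots> \<le> l" using v W'W W'V by (auto simp: blocked_def[OF ctx])
      finally show "v \<in> {v \<in> W'. card {S \<in> link E' v. S \<subseteq> I} \<le> l}" using v by simp
    qed
    then have "card (W' - ?X \<inter> W) \<le> card {v \<in> W'. card {S \<in> link E' v. S \<subseteq> I} \<le> l}"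
      using finW' by (intro card_mono) auto
    moreover have "card W' - card (?X \<inter> W) \<le> card (W' - ?X \<inter> W)"
      using finW by (intro diff_card_le_card_Diff) auto
    moreover have "card (?X \<inter> W) < h" using J by (intro W(4)) (auto simp: \<X>_def)
    ultimately have "real (card W') - real h \<le> real (card {v \<in> W'. card {S \<in> link E' v. S \<subseteq> I} \<le> l})"
      by linarith
    then show ?thesis using cW' h N by linarith
  qed
  obtain I where I: "I \<in> indep_sets W' E'" "(real N / 8)\<^sup>2 * (1/16) ^ l \<le> 4 * real (card W') * real (card I)"
    using large_independent_set_linear[OF finW' E' r lin tri few] by auto
  have "card W' \<le> N" using card_mono[OF finW W'W] W(2) by simp
  then have "4 * real (card W') * real (card I) \<le> 4 * real N * real m"
    using small[OF I(1)] by (intro mult_mono) auto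
  then have "(real N / 8)\<^sup>2 * (1/16) ^ l \<le> 4 * real N * real m" using I by linarith
  then have "(real N / 8)\<^sup>2 \<le> 4 * real N * real m * 16 ^ l"
    by (simp add: power_divide field_simps)
  \<comment> \<open>The 256 of \<open>fin\<close> is 64 * 4.\<close>
  then have "real N * real N \<le> real N * (256 * real m * 16 ^ l)"
    by (simp add: power2_eq_square field_simps)
  then have "real N \<le> 256 * real m * 16 ^ l" using n by (simp add: mult_le_cancel_left)
  with fin show False by simp
qed

text \<open>In terms of \<open>z = n powr (1 / (6 r\<^sup>2))\<close> the sample size is \<open>N \<approx> z ^ (6 r + 2)\<close>, the
  logarithmic gain is governed by \<open>16 ^ l \<le> z\<close>, and \<open>ln n\<close> is negligible against \<open>z\<close>.\<close>

lemma sampling_parameters: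
  fixes r K M :: nat
  assumes r: "r \<ge> 2" and K: "K \<ge> 1"
  shows "\<exists>c>0. \<forall>\<^sub>F n in sequentially. \<exists>N m l.
    2 \<le> N \<and> N \<le> n \<and> n \<le> N ^ r \<and> 40 * real M * real N ^ (3 * r) \<le> real N * real n ^ 3 \<and>
    m \<le> n \<and> real m * ln (real n) \<le> real N / 4 \<and>
    6 * real K * real m ^ r \<le> exp (-2) * real (l + 1) * real n \<and>
    256 * real m * 16 ^ l < real N \<and>
    c * (real n * ln (real n)) powr (1 / real r) \<le> real m"
proof -
  \<comment> \<open>With z = n^q, z^(6 r) = n^(1/r); for N about z^(6 r + 2), N^r is about n z^(2
    r), so (N^r / n)^3 is about z^(6 r) = N / z^2. This leaves a factor z^2 to absorb
    constants.\<close>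
  define q where "q = 1 / (6 * real r ^ 2)"
  \<comment> \<open>Chosen so that 16^(\<kappa> ln n) = n^q = z.\<close>
  define \<kappa> where "\<kappa> = q / ln 16"
  \<comment> \<open>2 c <= 1 gives (2 c)^r <= 2 c. In 108 = 2 * 6 * 9, the 2 pays for rounding
    \<open>m\<close> up, the 6 is that of the condition on \<open>l\<close>, and the 9 comes from 1
    / 9 <= exp(-2).\<close>
  define c where "c = min (1/2) (\<kappa> / (108 * real K))"
  have q: "q > 0" using r by (simp add: q_def)
  have \<kappa>: "\<kappa> > 0" using q by (simp add: \<kappa>_def)
  have c: "c > 0" "2 * c \<le> 1" "2 * c \<le> \<kappa> / (54 * real K)" using \<kappa> K by (auto simp: c_def min_def field_simps)
  \<comment> \<open>Lower bounds for z: \<open>40 * M\<close> absorbs the constant of the light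
    families, and 1 / c forces c y >= 1, so that rounding up at most doubles c y.\<close>
  let ?b = "max (max 2 (40 * real M)) (1 / c)"
  have "\<forall>\<^sub>F n in sequentially. ?b powr (1 / q) \<le> real n"
    using filterlim_real_sequentially unfolding filterlim_at_top by blast
  then have "\<forall>\<^sub>F n in sequentially. ?b \<le> real n powr q"
  proof eventually_elim
    case (elim n)
    have "(?b powr (1 / q)) powr q \<le> real n powr q" using elim q by (intro powr_mono2) auto
    moreover have "(?b powr (1 / q)) powr q = ?b" using q by (simp add: powr_powr)
    ultimately show ?case by simp
  qed
  \<comment> \<open>512 is twice the 256 of the last constraint, because rounding down may cost half
    of z^(6 r + 2).\<close>
  moreover have "\<forall>\<^sub>F n in sequentially. ln (real n) / real n powr q < 1 / 512"
    by (rule order_tendstoD(2)[OF lim_ln_over_power[OF q]]) simp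
  moreover have "\<forall>\<^sub>F n in sequentially. 3 \<le> n" by (rule eventually_ge_at_top)
  ultimately have "\<forall>\<^sub>F n in sequentially. \<exists>N m l.
    2 \<le> N \<and> N \<le> n \<and> n \<le> N ^ r \<and> 40 * real M * real N ^ (3 * r) \<le> real N * real n ^ 3 \<and>
    m \<le> n \<and> real m * ln (real n) \<le> real N / 4 \<and>
    6 * real K * real m ^ r \<le> exp (-2) * real (l + 1) * real n \<and>
    256 * real m * 16 ^ l < real N \<and>
    c * (real n * ln (real n)) powr (1 / real r) \<le> real m"
  proof eventually_elim
    case (elim n)
    define z where "z = real n powr q"
    define L where "L = ln (real n)"
    define y where "y = (real n * L) powr (1 / real r)"
    define N where "N = nat \<lfloor>z ^ (6 * r + 2)\<rfloor>"
    define m where "m = nat \<lceil>c * y\<rceil>"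
    define l where "l = nat \<lfloor>\<kappa> * L\<rfloor>"
    have n3: "real n \<ge> 3" using elim by simp
    have "exp 1 \<le> real n" using exp_le n3 by linarith
    then have L1: "L \<ge> 1" unfolding L_def using n3 by (subst ln_ge_iff) auto
    have z: "z \<ge> 2" "40 * real M \<le> z" "1 / c \<le> z" using elim by (auto simp: z_def)
    have zL: "512 * L < z" using elim z by (simp add: z_def L_def field_simps)
    have zpow: "z ^ (6 * r * r) = real n"
    proof -
      have "z ^ (6 * r * r) = real n powr (q * real (6 * r * r))"
        using n3 by (simp add: z_def powr_power mult_ac)
      also have "q * real (6 * r * r) = 1" using r by (simp add: q_def power2_eq_square)
      finally show ?thesis using n3 by simp
    qed
    have zmono: "z ^ a \<le> z ^ b" if "a \<le> b" for a b using z that by (intro power_increasing) auto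
    have z0: "z > 0" using z by simp
    have z6r: "z ^ (6 * r) = real n powr (1 / real r)"
    proof -
      have "z ^ (6 * r) = real n powr (q * real (6 * r))"
        using n3 by (simp add: z_def powr_power mult_ac)
      also have "q * real (6 * r) = 1 / real r" using r by (simp add: q_def power2_eq_square)
      finally show ?thesis .
    qed
    have y: "y = z ^ (6 * r) * L powr (1 / real r)"
      using n3 L1 by (simp add: y_def powr_mult z6r)
    have "L powr (1 / real r) \<le> L powr 1" using L1 r by (intro powr_mono) auto
    then have "L powr (1 / real r) \<le> L" using L1 by simp
    then have yle: "y \<le> z ^ (6 * r) * L" unfolding y using z0 by (intro mult_left_mono) auto
    have "1 \<le> L powr (1 / real r)" using L1 by (simp add: ge_one_powr_ge_zero)
    then have yge: "z ^ (6 * r) \<le> y" unfolding y using z0 by simp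
    have "z ^ 1 \<le> z ^ (6 * r)" using r by (intro zmono) simp
    then have "1 / c \<le> y" using yge z by simp
    then have cy: "1 \<le> c * y" using c by (simp add: field_simps)
    have mge: "c * y \<le> real m" and mle: "real m \<le> 2 * c * y"
      unfolding m_def using cy by linarith+
    have y0: "y \<ge> 0" by (simp add: y_def)
    have "2 * c * y \<le> 1 * y" using c y0 by (intro mult_right_mono) auto
    then have my: "real m \<le> z ^ (6 * r) * L" using mle yle by simp
    have yr: "y ^ r = real n * L" using r n3 L1 by (simp add: y_def powr_power)
    have zp: "0 \<le> z ^ (6 * r + 2)" using z0 by simp
    have Nle: "real N \<le> z ^ (6 * r + 2)" and Ngt: "z ^ (6 * r + 2) - 1 \<le> real N"
      unfolding N_def using zp by linarith+
    have z4: "4 \<le> z ^ 2" using power_mono[OF z(1), of 2] by simp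
    have z1: "1 \<le> z ^ (6 * r)" using z by (intro one_le_power) simp
    have "z ^ (6 * r) * 4 \<le> z ^ (6 * r) * z ^ 2" using z0 z4 by (intro mult_left_mono) auto
    then have z64: "4 * z ^ (6 * r) \<le> z ^ (6 * r + 2)" by (simp only: power_add mult.commute)
    have Nhalf: "z ^ (6 * r + 2) / 2 \<le> real N" and N6: "z ^ (6 * r) \<le> real N" and N2: "2 \<le> real N"
      using Ngt z64 z1 by linarith+
    have rr: "6 * r + 2 \<le> 6 * r * r"
    proof -
      have "6 * r * 2 \<le> 6 * r * r" using r by (intro mult_left_mono) auto
      then show ?thesis using r by linarith
    qed
    have c1: "2 \<le> N" using N2 by simp
    have "real N \<le> real n" using Nle zmono[OF rr] zpow by linarith
    then have c2: "N \<le> n" by simp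
    have "(z ^ (6 * r)) ^ r \<le> real N ^ r" using N6 z0 by (intro power_mono) auto
    then have "real n \<le> real (N ^ r)" using zpow by (simp add: power_mult[symmetric])
    then have c3: "n \<le> N ^ r" by (simp only: of_nat_le_iff)
    have c4: "40 * real M * real N ^ (3 * r) \<le> real N * real n ^ 3"
    proof -
      have "real N ^ (3 * r - 1) \<le> (z ^ (6 * r + 2)) ^ (3 * r - 1)" using Nle by (intro power_mono) auto
      also have "\<dots> = z ^ ((6 * r + 2) * (3 * r - 1))" by (simp only: power_mult)
      finally have "real N ^ (3 * r - 1) \<le> z ^ ((6 * r + 2) * (3 * r - 1))" .
      then have "(40 * real M) * real N ^ (3 * r - 1) \<le> z ^ 2 * z ^ ((6 * r + 2) * (3 * r - 1))"
      proof (intro mult_mono)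
        have "z ^ 1 \<le> z ^ 2" by (rule zmono) simp
        then show "40 * real M \<le> z ^ 2" using z by simp
      qed (use z0 in auto)
      also have "\<dots> = z ^ (2 + (6 * r + 2) * (3 * r - 1))" by (simp only: power_add)
      also have "2 + (6 * r + 2) * (3 * r - 1) = 6 * r * r * 3"
      proof -
        obtain s where "r = Suc s" using r by (cases r) auto
        then show ?thesis by (simp add: algebra_simps)
      qed
      also have "z ^ (6 * r * r * 3) = real n ^ 3" using zpow by (simp only: power_mult)
      finally have "(40 * real M) * real N ^ (3 * r - 1) \<le> real n ^ 3" .
      then have "real N * ((40 * real M) * real N ^ (3 * r - 1)) \<le> real N * real n ^ 3"
        by (rule mult_left_mono) simp
      moreover have "real N ^ (3 * r) = real N * real N ^ (3 * r - 1)"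
        using r by (cases "3 * r") auto
      ultimately show ?thesis by (simp add: mult_ac)
    qed
    have "z ^ (6 * r) * L \<le> z ^ (6 * r) * z" using zL L1 z0 by (intro mult_left_mono) auto
    also have "\<dots> = z ^ (6 * r + 1)" by simp
    also have "\<dots> \<le> z ^ (6 * r * r)" using rr by (intro zmono) simp
    finally have c5: "m \<le> n" using my zpow by simp
    have c6: "real m * L \<le> real N / 4"
    proof -
      have "real m * L \<le> z ^ (6 * r) * L * L" using my L1 by (intro mult_right_mono) auto
      also have "\<dots> = z ^ (6 * r) * (L * L)" by simp
      also have "\<dots> \<le> z ^ (6 * r) * ((z / 8) * z)"
        using zL L1 z0 by (intro mult_left_mono mult_mono) auto
      also have "\<dots> = z ^ (6 * r + 2) / 2 / 4" by (simp add: power2_eq_square)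
      also have "\<dots> \<le> real N / 4" using Nhalf by simp
      finally show ?thesis .
    qed
    have c7: "6 * real K * real m ^ r \<le> exp (-2) * real (l + 1) * real n"
    proof -
      have "real m ^ r \<le> (2 * c * y) ^ r" using mle by (intro power_mono) auto
      also have "\<dots> = (2 * c) ^ r * (real n * L)" by (simp add: power_mult_distrib yr)
      also have "(2 * c) ^ r \<le> (2 * c) ^ 1" using c r by (intro power_decreasing) auto
      finally have "real m ^ r \<le> 2 * c * (real n * L)" using L1 by (simp add: mult_right_mono)
      also have "\<dots> \<le> \<kappa> / (54 * real K) * (real n * L)" using c L1 by (intro mult_right_mono) auto
      finally have "6 * real K * real m ^ r \<le> 6 * real K * (\<kappa> / (54 * real K) * (real n * L))"
        by (rule mult_left_mono) simp
      also have "\<dots> = 1 / 9 * (\<kappa> * L) * real n" using K by simp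
      also have "\<dots> \<le> exp (-2) * real (l + 1) * real n"
      proof (intro mult_right_mono mult_mono)
        have "exp (2::real) = exp 1 ^ 2" using exp_of_nat_mult[of 2 "1::real"] by simp
        also have "\<dots> \<le> 3 ^ 2" by (rule power_mono[OF exp_le]) simp
        finally show "1 / 9 \<le> exp (-2::real)" by (simp add: exp_minus field_simps)
        show "\<kappa> * L \<le> real (l + 1)" unfolding l_def by linarith
      qed (use \<kappa> L1 in auto)
      finally show ?thesis .
    qed
    have c8: "256 * real m * 16 ^ l < real N"
    proof -
      have "0 \<le> \<kappa> * L" using \<kappa> L1 by simp
      then have lle: "real l \<le> \<kappa> * L" unfolding l_def by simp
      have "(16::real) ^ l = exp (real l * ln 16)" by (simp add: exp_of_nat_mult)
      also have "\<dots> \<le> exp (\<kappa> * L * ln 16)" using lle by simp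
      also have "\<kappa> * L * ln 16 = q * L" by (simp add: \<kappa>_def)
      also have "exp (q * L) = z" using n3 by (simp add: z_def powr_def L_def)
      finally have "256 * real m * 16 ^ l \<le> 256 * (z ^ (6 * r) * L) * z"
        using my z0 L1 by (intro mult_mono mult_left_mono) auto
      also have "\<dots> = z ^ (6 * r) * z * (512 * L) / 2" by simp
      also have "\<dots> < z ^ (6 * r) * z * z / 2"
        using zL z0 by (intro divide_strict_right_mono mult_strict_left_mono) auto
      also have "\<dots> = z ^ (6 * r + 2) / 2" by (simp add: power2_eq_square)
      finally show ?thesis using Nhalf by simp
    qed
    show ?case
      using c1 c2 c3 c4 c5 c6 c7 c8 mge unfolding L_def y_def by blast
  qed
  with c(1) show ?thesis by blast
qed

text \<open>The combinatorial interface: geometry has to supply one hypergraph of bounded codegree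
  and two light families.\<close>

theorem independent_set_bounded_codegree:
  fixes r K :: nat
  assumes r: "r \<ge> 2" and K: "K \<ge> 1"
  shows "\<exists>c>0. \<forall>\<^sub>F n in sequentially. \<forall>(V :: 'a set) E B1 B2.
    finite V \<and> card V = n \<and> bounded_codegree r K V E \<and> B1 \<subseteq> Pow V \<and> B2 \<subseteq> Pow V
      \<and> light n r K B1 \<and> light n r K B2 \<longrightarrow>
    (\<exists>S\<subseteq>V. (\<forall>e\<in>E \<union> B1 \<union> B2. \<not> e \<subseteq> S) \<and> c * (real n * ln (real n)) powr (1 / real r) \<le> real (card S))"
proof -
  let ?M = "2 * K + r * (K * 2 ^ (r + 1) * K) + K ^ 3 * (r + 1) ^ 3"
  obtain c where c: "c > 0" and ev: "\<forall>\<^sub>F n in sequentially. \<exists>N m l.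
    2 \<le> N \<and> N \<le> n \<and> n \<le> N ^ r \<and> 40 * real ?M * real N ^ (3 * r) \<le> real N * real n ^ 3 \<and>
    m \<le> n \<and> real m * ln (real n) \<le> real N / 4 \<and>
    6 * real K * real m ^ r \<le> exp (-2) * real (l + 1) * real n \<and>
    256 * real m * 16 ^ l < real N \<and>
    c * (real n * ln (real n)) powr (1 / real r) \<le> real m"
    using sampling_parameters[OF r K, of ?M] by blast
  show ?thesis
  proof (intro exI[of _ c] conjI c eventually_mono[OF ev] allI impI)
    fix n :: nat and V :: "'a set" and E B1 B2
    assume "\<exists>N m l.
    2 \<le> N \<and> N \<le> n \<and> n \<le> N ^ r \<and> 40 * real ?M * real N ^ (3 * r) \<le> real N * real n ^ 3 \<and>
    m \<le> n \<and> real m * ln (real n) \<le> real N / 4 \<and>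
    6 * real K * real m ^ r \<le> exp (-2) * real (l + 1) * real n \<and>
    256 * real m * 16 ^ l < real N \<and>
    c * (real n * ln (real n)) powr (1 / real r) \<le> real m"
    then obtain N m l where p: "2 \<le> N" "N \<le> n" "n \<le> N ^ r"
      "40 * real ?M * real N ^ (3 * r) \<le> real N * real n ^ 3"
      "m \<le> n" "real m * ln (real n) \<le> real N / 4"
      "6 * real K * real m ^ r \<le> exp (-2) * real (l + 1) * real n" "256 * real m * 16 ^ l < real N"
      and m: "c * (real n * ln (real n)) powr (1 / real r) \<le> real m"
      by blast
    assume "finite V \<and> card V = n \<and> bounded_codegree r K V E \<and> B1 \<subseteq> Pow V \<and> B2 \<subseteq> Pow V
      \<and> light n r K B1 \<and> light n r K B2"
    then have "\<exists>S\<subseteq>V. (\<forall>e\<in>E \<union> B1 \<union> B2. \<not> e \<subseteq> S) \<and> m \<le> card S"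
      by (intro independent_set_core[OF _ _ _ r _ _ _ _ p]) auto
    then obtain S where "S \<subseteq> V" "\<forall>e\<in>E \<union> B1 \<union> B2. \<not> e \<subseteq> S" "m \<le> card S" by blast
    moreover from \<open>m \<le> card S\<close> m have "c * (real n * ln (real n)) powr (1 / real r) \<le> real (card S)" by linarith
    ultimately show "\<exists>S\<subseteq>V. (\<forall>e\<in>E \<union> B1 \<union> B2. \<not> e \<subseteq> S)
      \<and> c * (real n * ln (real n)) powr (1 / real r) \<le> real (card S)" by blast
  qed
qed

section \<open>Sign patterns of hyperplane arrangements\<close>

definition shatters :: "'a set set \<Rightarrow> 'a set \<Rightarrow> bool" where
  "shatters \<F> T \<longleftrightarrow> (\<forall>S\<subseteq>T. \<exists>A\<in>\<F>. A \<inter> T = S)"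

text \<open>A crude Sauer-Shelah bound. Removing \<open>x\<close> leaves the traces and, counted
  once more, the sets occurring both with and without \<open>x\<close>; the latter shatter no set of
  size k - 1, and (v + 1)^j + (v + 1)^(j - 1) <= (v + 2)^j closes the induction. For k = 0 not even
  {} is shattered, which forces an empty family.\<close>

lemma card_le_if_not_shatters:
  assumes "finite V" "\<F> \<subseteq> Pow V" "\<And>T. T \<subseteq> V \<Longrightarrow> card T = k \<Longrightarrow> \<not> shatters \<F> T"
  shows "card \<F> \<le> (if k = 0 then 0 else (card V + 1) ^ (k - 1))"
  using assms
proof (induction V arbitrary: \<F> k rule: finite_induct)
  case empty
  show ?case
  proof (cases "\<F> = {}")
    case False
    then have F: "\<F> = {{}}" using empty by auto
    then have "shatters \<F> {}" by (auto simp: shatters_def)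
    then have "k \<noteq> 0" using empty.prems(2)[of "{}"] by auto
    then show ?thesis using F by simp
  qed simp
next
  case (insert x V)
  show ?case
  proof (cases k)
    case 0
    have "\<not> shatters \<F> {}" using insert.prems(2)[of "{}"] 0 by simp
    then have "\<F> = {}" by (auto simp: shatters_def)
    then show ?thesis by simp
  next
    case (Suc j)
    let ?F1 = "(\<lambda>A. A - {x}) ` \<F>" and ?F2 = "{A \<in> \<F>. x \<notin> A \<and> insert x A \<in> \<F>}"
    have finF: "finite \<F>" using insert by (auto intro: finite_subset)
    have F1: "card ?F1 \<le> (if k = 0 then 0 else (card V + 1) ^ (k - 1))"
    proof (rule insert.IH)
      fix T assume T: "T \<subseteq> V" "card T = k"
      then have xT: "x \<notin> T" using insert by auto
      show "\<not> shatters ?F1 T"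
      proof
        assume sh: "shatters ?F1 T"
        have "shatters \<F> T" unfolding shatters_def
        proof (intro allI impI)
          fix S assume "S \<subseteq> T"
          then obtain A where "A \<in> \<F>" "(A - {x}) \<inter> T = S" using sh by (auto simp: shatters_def)
          then show "\<exists>A\<in>\<F>. A \<inter> T = S" using xT by (intro bexI[of _ A]) auto
        qed
        then show False using insert.prems(2)[of T] T by auto
      qed
    qed (use insert in auto)
    have F2: "card ?F2 \<le> (if j = 0 then 0 else (card V + 1) ^ (j - 1))"
    proof (rule insert.IH)
      fix T assume T: "T \<subseteq> V" "card T = j"
      then have xT: "x \<notin> T" using insert by auto
      have finT: "finite T" using T(1) insert.hyps(1) by (rule finite_subset)
      show "\<not> shatters ?F2 T"
      proof
        assume sh: "shatters ?F2 T"
        have "shatters \<F> (insert x T)" unfolding shatters_def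
        proof (intro allI impI)
          fix S assume S: "S \<subseteq> insert x T"
          then have "S - {x} \<subseteq> T" by auto
          then obtain A where A: "A \<in> ?F2" "A \<inter> T = S - {x}" using sh unfolding shatters_def by blast
          show "\<exists>A\<in>\<F>. A \<inter> insert x T = S"
          proof (cases "x \<in> S")
            case True then show ?thesis using A xT by (intro bexI[of _ "insert x A"]) auto
          next
            case False then show ?thesis using A xT by (intro bexI[of _ A]) auto
          qed
        qed
        then show False using insert.prems(2)[of "insert x T"] T xT finT Suc by auto
      qed
    qed (use insert in auto)
    have "card \<F> \<le> card ?F1 + card ?F2"
    proof -
      let ?G = "\<F> - ?F2"
      have "inj_on (\<lambda>A. A - {x}) ?G"
      proof (rule inj_onI)
        fix A B assume AB: "A \<in> ?G" "B \<in> ?G" "A - {x} = B - {x}"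
        show "A = B"
        proof (rule ccontr)
          assume "A \<noteq> B"
          then consider "x \<in> A" "x \<notin> B" "A = insert x B" | "x \<notin> A" "x \<in> B" "B = insert x A" using AB(3) by blast
          then show False using AB by cases auto
        qed
      qed
      then have "card ?G \<le> card ?F1" using finF by (intro card_inj_on_le[of "\<lambda>A. A - {x}"]) auto
      moreover have "card \<F> \<le> card ?G + card ?F2"
        using finF card_Diff_subset[of ?F2 \<F>] card_mono[of \<F> ?F2] by auto
      ultimately show ?thesis by linarith
    qed
    also have "\<dots> \<le> (card V + 2) ^ j"
    proof (cases j)
      case 0
      then show ?thesis using F1 F2 Suc by simp
    next
      case (Suc i)
      have "card ?F1 + card ?F2 \<le> (card V + 1) ^ j + (card V + 1) ^ i"
        using F1 F2 \<open>k = Suc j\<close> Suc by simp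
      also have "\<dots> = (card V + 2) * (card V + 1) ^ i" using Suc by simp
      also have "\<dots> \<le> (card V + 2) * (card V + 2) ^ i" by (intro mult_left_mono power_mono) auto
      finally show ?thesis using Suc by simp
    qed
    finally show ?thesis using Suc insert by simp
  qed
qed

text \<open>Indexed because distinct hyperplanes may have equal projected normals; two equal vectors
  already give a relation.\<close>

lemma indexed_dependence:
  fixes p :: "'i \<Rightarrow> 'a::euclidean_space"
  assumes T: "finite T" "p ` T \<subseteq> D" "dim D < card T"
  shows "\<exists>c. (\<exists>i\<in>T. c i \<noteq> 0) \<and> (\<Sum>i\<in>T. c i *\<^sub>R p i) = 0"
proof (cases "inj_on p T")
  case True
  then have "card (p ` T) = card T" by (rule card_image)
  moreover have "dim (p ` T) \<le> dim D" by (rule dim_subset[OF T(2)])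
  ultimately have "dependent (p ` T)" using T independent_bound_general[of "p ` T"] by linarith
  then obtain u where u: "\<exists>v\<in>p ` T. u v \<noteq> 0" "(\<Sum>v\<in>p ` T. u v *\<^sub>R v) = 0"
    using dependent_finite[of "p ` T"] T by auto
  then show ?thesis using True
    by (intro exI[of _ "u \<circ> p"]) (auto simp: sum.reindex)
next
  case False
  then obtain i j where ij: "i \<in> T" "j \<in> T" "i \<noteq> j" "p i = p j" by (auto simp: inj_on_def)
  let ?c = "\<lambda>k. if k = i then 1 else if k = j then -1 else (0::real)"
  have "(\<Sum>k\<in>T. ?c k *\<^sub>R p k) = (\<Sum>k\<in>{i, j}. ?c k *\<^sub>R p k)"
    using T ij by (intro sum.mono_neutral_right) auto
  also have "\<dots> = 0" using ij by simp
  finally show ?thesis using ij by (intro exI[of _ ?c]) auto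
qed

text \<open>Prescribe a linear functional on the independent vectors and represent it by the vector
  \<open>adjoint g 1\<close>.\<close>

lemma inner_system_solvable:
  fixes a :: "'i \<Rightarrow> 'a::euclidean_space"
  assumes "inj_on a T" "independent (a ` T)"
  shows "\<exists>w. \<forall>i\<in>T. a i \<bullet> w = f i"
proof -
  obtain g :: "'a \<Rightarrow> real" where g: "linear g" "\<forall>x\<in>a ` T. g x = f (inv_into T a x)"
    using linear_independent_extend[OF assms(2), of "\<lambda>x. f (inv_into T a x)"] by blast
  have "a i \<bullet> adjoint g 1 = f i" if "i \<in> T" for i
    using adjoint_works[OF g(1), of "a i" 1] g(2) that assms(1) by simp
  then show ?thesis by blast
qed

lemma projection_exists:
  fixes x :: "'a::euclidean_space"
  assumes "subspace D"
  obtains p where "p \<in> D" "\<And>u. u \<in> D \<Longrightarrow> (x - p) \<bullet> u = 0"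
proof -
  obtain y z where "y \<in> span D" "\<And>w. w \<in> span D \<Longrightarrow> orthogonal z w" "x = y + z"
    using orthogonal_subspace_decomp_exists[of D x] by metis
  then show thesis using assms that[of y] by (simp add: span_eq_iff[THEN iffD2] orthogonal_def)
qed

section \<open>Cells, sign patterns and facets\<close>

locale arrangement =
  fixes H :: "'a::euclidean_space set set" and a :: "'a set \<Rightarrow> 'a" and b :: "'a set \<Rightarrow> real"
  assumes finH: "finite H" and hyp: "\<And>h. h \<in> H \<Longrightarrow> a h \<noteq> 0 \<and> h = {x. a h \<bullet> x = b h}"
begin

definition side :: "'a \<Rightarrow> 'a set \<Rightarrow> real" where
  "side x h = sgn (a h \<bullet> x - b h)"

definition pos :: "'a \<Rightarrow> 'a set set" where
  "pos x = {h \<in> H. a h \<bullet> x > b h}"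

definition U :: "'a set" where
  "U = span (a ` H)"

lemma subspace_U: "subspace U" by (simp add: U_def)

lemma a_in_U: "h \<in> H \<Longrightarrow> a h \<in> U" by (simp add: U_def span_base)

lemma complement_iff: "x \<in> UNIV - \<Union>H \<longleftrightarrow> (\<forall>h\<in>H. a h \<bullet> x \<noteq> b h)"
  using hyp by blast

text \<open>A connected part of the complement cannot cross a hyperplane, by the intermediate value
  theorem; conversely the region of constant signs is convex, hence connected, and components are
  maximal.\<close>

lemma cell_eq:
  assumes C: "C \<in> cells H" and x: "x \<in> C"
  shows "C = {y. \<forall>h\<in>H. 0 < side x h * (a h \<bullet> y - b h)}" (is "C = ?R")
proof
  have CX: "C \<subseteq> UNIV - \<Union>H" and conn: "connected C"
    using C in_components_subset in_components_connected by (auto simp: cells_def)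
  have nz: "a h \<bullet> y \<noteq> b h" if "y \<in> C" "h \<in> H" for y h
    using CX that complement_iff by blast
  show "C \<subseteq> ?R"
  proof clarify
    fix y h assume y: "y \<in> C" and h: "h \<in> H"
    have ny: "a h \<bullet> y \<noteq> b h" and nx: "a h \<bullet> x \<noteq> b h" using nz y x h by auto
    show "0 < side x h * (a h \<bullet> y - b h)"
    proof (rule ccontr)
      assume "\<not> ?thesis"
      then have "(a h \<bullet> x < b h \<and> b h < a h \<bullet> y) \<or> (a h \<bullet> y < b h \<and> b h < a h \<bullet> x)"
        using nx ny by (auto simp: side_def sgn_if split: if_splits)
      then obtain z where "z \<in> C" "a h \<bullet> z = b h"
        using connected_ivt_hyperplane[OF conn x y, of "a h" "b h"]
          connected_ivt_hyperplane[OF conn y x, of "a h" "b h"] by force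
      then show False using nz h by blast
    qed
  qed
  have Req: "?R = (\<Inter>h\<in>H. {y. side x h * b h < (side x h *\<^sub>R a h) \<bullet> y})"
    by (auto simp: algebra_simps)
  have "convex ?R" unfolding Req
    by (intro convex_INT convex_halfspace_gt)
  then have "connected ?R" by (rule convex_connected)
  moreover have "?R \<subseteq> UNIV - \<Union>H" unfolding subset_iff complement_iff by auto
  moreover have "0 < side x h * (a h \<bullet> x - b h)" if "h \<in> H" for h
    using nz[OF x that] by (cases "a h \<bullet> x < b h") (auto simp: side_def sgn_if)
  then have "x \<in> ?R" by blast
  ultimately show "?R \<subseteq> C"
    using components_maximal[of C "UNIV - \<Union>H" ?R] C x unfolding cells_def by blast
qed

lemma cell_cong:
  assumes "C \<in> cells H" "C' \<in> cells H" "x \<in> C" "x' \<in> C'" "pos x = pos x'"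
  shows "C = C'"
proof -
  have "a h \<bullet> y \<noteq> b h" if "y \<in> D" "D \<in> cells H" "h \<in> H" for y D h
  proof -
    have "D \<subseteq> UNIV - \<Union>H" using that in_components_subset by (auto simp: cells_def)
    then show ?thesis using that complement_iff by blast
  qed
  then have ne: "a h \<bullet> x \<noteq> b h" "a h \<bullet> x' \<noteq> b h" if "h \<in> H" for h using that assms by blast+
  have "side x h = side x' h" if h: "h \<in> H" for h
  proof -
    have "h \<in> pos x \<longleftrightarrow> h \<in> pos x'" using assms(5) by simp
    then show ?thesis using ne[OF h] h by (auto simp: pos_def side_def sgn_if)
  qed
  then show ?thesis unfolding cell_eq[OF assms(1,3)] cell_eq[OF assms(2,4)] by auto
qed

text \<open>The projections of k + 1 normals to \<open>D\<close> are dependent, so some combination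
  \<open>f\<close> of the defining forms is constant on \<open>Y\<close>. If the patterns c > 0 and
  c < 0 were both realised, \<open>f\<close> would be positive at one point and nonpositive at
  another; hence no (k + 1)-set is shattered.\<close>

lemma card_sign_patterns:
  assumes D: "subspace D" "dim D \<le> k" and Y: "Y \<subseteq> UNIV - \<Union>H" "\<And>y y'. y \<in> Y \<Longrightarrow> y' \<in> Y \<Longrightarrow> y - y' \<in> D"
  shows "card (pos ` Y) \<le> (card H + 1) ^ k"
proof -
  have "card (pos ` Y) \<le> (if Suc k = 0 then 0 else (card H + 1) ^ (Suc k - 1))"
  proof (rule card_le_if_not_shatters[OF finH])
    show "pos ` Y \<subseteq> Pow H" by (auto simp: pos_def)
    fix T assume T: "T \<subseteq> H" "card T = Suc k"
    have finT: "finite T" using T(1) finH by (rule finite_subset)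
    have "\<exists>p. p \<in> D \<and> (\<forall>u\<in>D. (a h - p) \<bullet> u = 0)" for h
      using projection_exists[OF D(1), of "a h"] by metis
    then obtain p where p: "\<And>h. p h \<in> D" "\<And>h u. u \<in> D \<Longrightarrow> (a h - p h) \<bullet> u = 0" by metis
    obtain c where c: "\<exists>h\<in>T. c h \<noteq> 0" "(\<Sum>h\<in>T. c h *\<^sub>R p h) = 0"
      using indexed_dependence[of T p D] finT p(1) D(2) T(2) by auto
    define f where "f x = (\<Sum>h\<in>T. c h * (a h \<bullet> x - b h))" for x
    have const: "f y = f y'" if y: "y \<in> Y" "y' \<in> Y" for y y'
    proof -
      have "f y - f y' = (\<Sum>h\<in>T. c h * (a h \<bullet> (y - y')))"
        unfolding f_def by (simp add: sum_subtractf[symmetric] inner_diff_right algebra_simps)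
      also have "\<dots> = (\<Sum>h\<in>T. c h * (p h \<bullet> (y - y')))"
        using p(2)[OF Y(2)[OF y]] by (simp add: inner_diff_left)
      also have "\<dots> = (\<Sum>h\<in>T. c h *\<^sub>R p h) \<bullet> (y - y')" by (simp add: inner_sum_left)
      also have "\<dots> = 0" by (simp only: c(2) inner_zero_left)
      finally show ?thesis by simp
    qed
    have ne: "a h \<bullet> y \<noteq> b h" if "y \<in> Y" "h \<in> T" for y h using that Y(1) T complement_iff by blast
    obtain h0 where h0: "h0 \<in> T" "c h0 \<noteq> 0" using c by blast
    show "\<not> shatters (pos ` Y) T"
    proof
      assume sh: "shatters (pos ` Y) T"
      obtain y where y: "y \<in> Y" "pos y \<inter> T = {h \<in> T. c h > 0}"
        using sh[unfolded shatters_def, rule_format, of "{h \<in> T. c h > 0}"] by auto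
      obtain y' where y': "y' \<in> Y" "pos y' \<inter> T = {h \<in> T. c h < 0}"
        using sh[unfolded shatters_def, rule_format, of "{h \<in> T. c h < 0}"] by auto
      have sgn1: "c h > 0 \<longleftrightarrow> a h \<bullet> y > b h" if "h \<in> T" for h using y(2) that T by (auto simp: pos_def)
      have sgn2: "c h < 0 \<longleftrightarrow> a h \<bullet> y' > b h" if "h \<in> T" for h using y'(2) that T by (auto simp: pos_def)
      have t1: "c h * (a h \<bullet> y - b h) \<ge> 0" "c h \<noteq> 0 \<Longrightarrow> c h * (a h \<bullet> y - b h) > 0" if "h \<in> T" for h
        using sgn1[OF that] ne[OF y(1) that]
        by (cases "c h > 0"; cases "c h = 0"; simp add: mult_nonpos_nonpos mult_neg_neg)+
      have t2: "c h * (a h \<bullet> y' - b h) \<le> 0" if "h \<in> T" for h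
        using sgn2[OF that] ne[OF y'(1) that]
        by (cases "c h < 0") (auto simp: mult_nonneg_nonpos mult_nonpos_nonneg)
      have "f y > 0" unfolding f_def
        by (rule sum_pos2[OF finT h0(1)]) (use t1 h0 in auto)
      moreover have "f y' \<le> 0" unfolding f_def by (rule sum_nonpos) (use t2 in auto)
      ultimately show False using const[OF y(1) y'(1)] by simp
    qed
  qed
  then show ?thesis by simp
qed

lemma side_nonzero:
  assumes C: "C \<in> cells H" and x: "x \<in> C" and h: "h \<in> H"
  shows "side x h \<noteq> 0" "side x h * (a h \<bullet> x - b h) > 0"
proof -
  show "side x h * (a h \<bullet> x - b h) > 0" using cell_eq[OF C x] x h by blast
  then show "side x h \<noteq> 0" by auto
qed

text \<open>A point satisfying the weak inequalities is a limit of the open segment from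
  \<open>x\<close>, on which all inequalities are strict.\<close>

lemma closure_cell:
  assumes C: "C \<in> cells H" and x: "x \<in> C"
  shows "closure C = (\<Inter>h\<in>H. {y. 0 \<le> side x h * (a h \<bullet> y - b h)})" (is "_ = ?P")
proof
  have P: "?P = (\<Inter>h\<in>H. {y. (side x h *\<^sub>R a h) \<bullet> y \<ge> side x h * b h})"
    by (auto simp: algebra_simps)
  have "closed ?P" unfolding P by (intro closed_INT ballI closed_halfspace_ge)
  moreover have "C \<subseteq> ?P" using cell_eq[OF C x] by (auto intro: less_imp_le)
  ultimately show "closure C \<subseteq> ?P" by (simp add: closure_minimal)
  show "?P \<subseteq> closure C"
  proof
    fix y assume y: "y \<in> ?P"
    show "y \<in> closure C"
    proof (cases "x = y")
      case True then show ?thesis using x closure_subset by auto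
    next
      case False
      have "open_segment x y \<subseteq> C"
      proof
        fix z assume "z \<in> open_segment x y"
        then obtain u where u: "0 < u" "u < 1" "z = (1 - u) *\<^sub>R x + u *\<^sub>R y" by (auto simp: in_segment)
        have "0 < side x h * (a h \<bullet> z - b h)" if h: "h \<in> H" for h
        proof -
          have "0 < (1 - u) * (side x h * (a h \<bullet> x - b h))"
            by (rule mult_pos_pos) (use u side_nonzero(2)[OF C x h] in linarith)+
          moreover have "0 \<le> u * (side x h * (a h \<bullet> y - b h))" 
            by (rule mult_nonneg_nonneg) (use y h u in auto)
          moreover have "side x h * (a h \<bullet> z - b h)
              = (1 - u) * (side x h * (a h \<bullet> x - b h)) + u * (side x h * (a h \<bullet> y - b h))"
            unfolding u(3) by (simp add: inner_add_right algebra_simps)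
          ultimately show ?thesis by linarith
        qed
        then show "z \<in> C" using cell_eq[OF C x] by blast
      qed
      then have "closure (open_segment x y) \<subseteq> closure C" by (rule closure_mono)
      then show ?thesis using False by auto
    qed
  qed
qed

text \<open>A smallest subfamily of half-spaces with the same intersection is irredundant, and then
  \<open>facet_of_polyhedron_explicit\<close> turns each half-space into a facet. Strict
  inequalities return because an open convex set is the interior of its closure.\<close>

lemma cell_cut_out_by_facets:
  assumes C: "C \<in> cells H" and x: "x \<in> C"
  shows "\<exists>F\<subseteq>facet_hyperplanes H C. C = {y. \<forall>h\<in>F. 0 < side x h * (a h \<bullet> y - b h)}"
proof -
  define Hs where "Hs h = {y. 0 \<le> side x h * (a h \<bullet> y - b h)}" for h
  have cl: "closure C = \<Inter>(Hs ` H)" using closure_cell[OF C x] by (simp add: Hs_def)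
  define \<G> where "\<G> = {G. G \<subseteq> H \<and> \<Inter>(Hs ` G) = closure C}"
  have "H \<in> \<G>" using cl by (simp add: \<G>_def)
  then obtain F where F: "F \<in> \<G>" "\<And>G. G \<in> \<G> \<Longrightarrow> card F \<le> card G"
    using ex_has_least_nat[of "\<lambda>G. G \<in> \<G>" H card] by blast
  have FH: "F \<subseteq> H" and FC: "\<Inter>(Hs ` F) = closure C" using F by (auto simp: \<G>_def)
  have finF: "finite F" using FH finH by (rule finite_subset)
  have min: "\<Inter>(Hs ` G) \<noteq> closure C" if "G \<subset> F" for G
    using F(2)[of G] psubset_card_mono[OF finF that] that FH by (auto simp: \<G>_def)
  \<comment> \<open>The facet theorem speaks of a set of half-spaces, so \<open>h\<close> must be
    recoverable from \<open>Hs h\<close>; a repetition would contradict minimality.\<close>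
  have inj: "inj_on Hs F"
  proof (rule inj_onI, rule ccontr)
    fix h h' assume hh: "h \<in> F" "h' \<in> F" "Hs h = Hs h'" "h \<noteq> h'"
    then have "Hs ` (F - {h'}) = Hs ` F" by (metis (no_types, opaque_lifting) Diff_iff image_insert insert_Diff insert_absorb imageI singletonD)
    then show False using min[of "F - {h'}"] hh FC by auto
  qed
  have Copen: "C = {y. \<forall>h\<in>H. 0 < side x h * (a h \<bullet> y - b h)}" by (rule cell_eq[OF C x])
  have op: "open {y. \<forall>h\<in>G. 0 < side x h * (a h \<bullet> y - b h)}" if "finite G" for G
  proof -
    have "{y. \<forall>h\<in>G. 0 < side x h * (a h \<bullet> y - b h)} = (\<Inter>h\<in>G. {y. side x h * b h < (side x h *\<^sub>R a h) \<bullet> y})"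
      by (auto simp: algebra_simps)
    moreover have "open \<dots>" using that by (intro open_INT ballI open_halfspace_gt)
    ultimately show ?thesis by simp
  qed
  have openC: "open C" by (subst Copen) (rule op[OF finH])
  have convC: "convex C"
  proof -
    have "C = (\<Inter>h\<in>H. {y. side x h * b h < (side x h *\<^sub>R a h) \<bullet> y})"
      by (subst Copen) (auto simp: algebra_simps)
    moreover have "convex \<dots>" by (intro convex_INT convex_halfspace_gt)
    ultimately show ?thesis by simp
  qed
  have aff: "affine hull closure C = UNIV"
  proof -
    have "affine hull C = UNIV" using affine_hull_open[OF openC] x by auto
    then show ?thesis by (metis closure_subset hull_mono top.extremum_uniqueI)
  qed
  define a' where "a' S = - (side x (inv_into F Hs S) *\<^sub>R a (inv_into F Hs S))" for S
  define b' where "b' S = - (side x (inv_into F Hs S) * b (inv_into F Hs S))" for S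
  have facet: "D facet_of closure C \<longleftrightarrow> (\<exists>S. S \<in> Hs ` F \<and> D = closure C \<inter> {y. a' S \<bullet> y = b' S})" for D
  proof (rule facet_of_polyhedron_explicit)
    show "finite (Hs ` F)" using finF by simp
    show "closure C = affine hull closure C \<inter> \<Inter>(Hs ` F)" using aff FC by simp
  next
    fix S assume "S \<in> Hs ` F"
    then obtain h where h: "h \<in> F" "S = Hs h" by blast
    then have inv: "inv_into F Hs S = h" using inj by simp
    have "h \<in> H" using h FH by blast
    then have "a' S \<noteq> 0" using hyp[of h] side_nonzero[OF C x, of h] by (simp add: a'_def inv)
    moreover have e: "a' S = - (side x h *\<^sub>R a h)" "b' S = - (side x h * b h)"
      by (simp_all add: a'_def b'_def inv)
    have "S = {y. a' S \<bullet> y \<le> b' S}"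
      unfolding e by (auto simp: h(2) Hs_def algebra_simps)
    ultimately show "a' S \<noteq> 0 \<and> S = {y. a' S \<bullet> y \<le> b' S}" by blast
  next
    fix \<F>' assume sub: "\<F>' \<subset> Hs ` F"
    define G where "G = {h \<in> F. Hs h \<in> \<F>'}"
    have G: "Hs ` G = \<F>'" using sub by (auto simp: G_def)
    have "G \<subset> F" using sub G by (auto simp: G_def)
    then have "\<Inter>\<F>' \<noteq> closure C" using min G by blast
    moreover have "closure C \<subseteq> \<Inter>\<F>'" using sub unfolding FC[symmetric] by (intro Inf_superset_mono) auto
    ultimately show "closure C \<subset> affine hull closure C \<inter> \<Inter>\<F>'" using aff by auto
  qed
  have "F \<subseteq> facet_hyperplanes H C"
  proof
    fix h assume h: "h \<in> F"
    let ?D = "closure C \<inter> {y. a' (Hs h) \<bullet> y = b' (Hs h)}"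
    have inv: "inv_into F Hs (Hs h) = h" using inj h by simp
    have hH: "h \<in> H" using h FH by blast
    have "?D facet_of closure C" using facet h by blast
    moreover have "?D \<subseteq> h"
    proof
      fix y assume "y \<in> ?D"
      then have "side x h * (a h \<bullet> y) = side x h * b h" by (simp add: a'_def b'_def inv)
      then have "a h \<bullet> y = b h" using side_nonzero[OF C x hH] by simp
      then show "y \<in> h" using hyp[OF hH] by blast
    qed
    ultimately show "h \<in> facet_hyperplanes H C" using hH by (auto simp: facet_hyperplanes_def)
  qed
  moreover have "C = {y. \<forall>h\<in>F. 0 < side x h * (a h \<bullet> y - b h)}" (is "_ = ?R")
  proof
    show "C \<subseteq> ?R" by (subst Copen) (use FH in auto)
    have "?R \<subseteq> closure C" unfolding FC[symmetric] Hs_def by (auto intro: less_imp_le)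
    then have "?R \<subseteq> interior (closure C)" using op[OF finF] by (intro interior_maximal)
    then show "?R \<subseteq> C" using convex_interior_closure[OF convC] interior_open[OF openC] by simp
  qed
  ultimately show ?thesis by blast
qed

text \<open>Orthogonal projection to the span of the normals changes none of the defining
  forms.\<close>

lemma point_in_U:
  obtains p where "p \<in> U" "\<And>h. h \<in> H \<Longrightarrow> a h \<bullet> p = a h \<bullet> x"
proof -
  obtain p where p: "p \<in> U" "\<And>u. u \<in> U \<Longrightarrow> (x - p) \<bullet> u = 0"
    using projection_exists[OF subspace_U] by metis
  have "a h \<bullet> p = a h \<bullet> x" if "h \<in> H" for h
  proof -
    have "a h \<bullet> (x - p) = 0" using p(2)[OF a_in_U[OF that]] by (metis inner_commute)
    then show ?thesis by (simp add: inner_diff_right)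
  qed
  then show ?thesis using that p(1) by blast
qed

lemma cell_meets_U:
  assumes C: "C \<in> cells H"
  shows "\<exists>x. x \<in> C \<and> x \<in> U"
proof -
  obtain x where x: "x \<in> C" using C in_components_nonempty by (auto simp: cells_def)
  obtain p where p: "p \<in> U" "\<And>h. h \<in> H \<Longrightarrow> a h \<bullet> p = a h \<bullet> x" using point_in_U[of x] by auto
  have "p \<in> C" by (subst cell_eq[OF C x]) (use p(2) side_nonzero[OF C x] in auto)
  then show ?thesis using p by blast
qed

section \<open>Chosen facets and free cells\<close>

definition rep :: "'a set \<Rightarrow> 'a" where
  "rep C = (SOME x. x \<in> C \<and> x \<in> U)"

text \<open>Inclusion in the facet hyperplanes is enough: a set that fails to contain part of a
  hyperedge fails to contain the hyperedge.\<close>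

definition bounding :: "'a set \<Rightarrow> 'a set set" where
  "bounding C = (SOME F. F \<subseteq> facet_hyperplanes H C \<and> C = {y. \<forall>h\<in>F. 0 < side (rep C) h * (a h \<bullet> y - b h)})"

lemma rep: "C \<in> cells H \<Longrightarrow> rep C \<in> C" "C \<in> cells H \<Longrightarrow> rep C \<in> U"
  using someI_ex[OF cell_meets_U] by (auto simp: rep_def)

lemma bounding:
  assumes "C \<in> cells H"
  shows "bounding C \<subseteq> facet_hyperplanes H C" "C = {y. \<forall>h\<in>bounding C. 0 < side (rep C) h * (a h \<bullet> y - b h)}" "bounding C \<subseteq> H"
proof -
  show *: "bounding C \<subseteq> facet_hyperplanes H C" and "C = {y. \<forall>h\<in>bounding C. 0 < side (rep C) h * (a h \<bullet> y - b h)}"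
    using someI_ex[OF cell_cut_out_by_facets[OF assms rep(1)[OF assms]]] unfolding bounding_def by blast+
  show "bounding C \<subseteq> H" using * by (auto simp: facet_hyperplanes_def)
qed

text \<open>Directions orthogonal to all normals stay inside every cell, so mere unboundedness would
  say nothing when the normals do not span; hence the restriction to \<open>U\<close>.\<close>

definition free :: "'a set \<Rightarrow> bool" where
  "free C \<longleftrightarrow> (\<exists>y\<in>U. y \<noteq> 0 \<and> (\<forall>x\<in>C. \<forall>t\<ge>0. x + t *\<^sub>R y \<in> C))"

lemma freeI:
  assumes C: "C \<in> cells H" and y: "y \<in> U" "y \<noteq> 0" "\<And>h. h \<in> bounding C \<Longrightarrow> 0 \<le> side (rep C) h * (a h \<bullet> y)"
  shows "free C"
proof -
  have "x + t *\<^sub>R y \<in> C" if "x \<in> C" "t \<ge> 0" for x t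
  proof -
    have "0 < side (rep C) h * (a h \<bullet> (x + t *\<^sub>R y) - b h)" if h: "h \<in> bounding C" for h
    proof -
      have "0 < side (rep C) h * (a h \<bullet> x - b h)" using bounding(2)[OF C] \<open>x \<in> C\<close> h by blast
      moreover have "0 \<le> t * (side (rep C) h * (a h \<bullet> y))" using y(3)[OF h] \<open>t \<ge> 0\<close> by simp
      ultimately show ?thesis by (simp add: inner_add_right algebra_simps)
    qed
    then show ?thesis by (subst bounding(2)[OF C]) blast
  qed
  then show ?thesis using y unfolding free_def by blast
qed

text \<open>A direction in \<open>U\<close> orthogonal to the chosen normals gives a whole line
  inside the cell. Any hyperplane not parallel to it would be hit, so the direction is orthogonal to
  all of \<open>U\<close>, hence zero.\<close>

lemma span_facet_normals:
  assumes C: "C \<in> cells H"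
  shows "span (a ` bounding C) = U"
proof (rule ccontr)
  assume ne: "span (a ` bounding C) \<noteq> U"
  have "span (a ` bounding C) \<subseteq> span (a ` H)" using bounding(3)[OF C] by (intro span_mono image_mono)
  then have "span (a ` bounding C) \<subset> span (a ` H)" using ne by (auto simp: U_def)
  then obtain y where y: "y \<noteq> 0" "y \<in> span (a ` H)" "\<And>v. v \<in> span (a ` bounding C) \<Longrightarrow> orthogonal y v"
    using orthogonal_to_subspace_exists_gen by metis
  have perp: "a h \<bullet> y = 0" if "h \<in> bounding C" for h
    using y(3)[of "a h"] that by (auto simp: span_base orthogonal_def inner_commute)
  let ?x = "rep C"
  have line: "?x + t *\<^sub>R y \<in> C" for t
  proof -
    have "0 < side ?x h * (a h \<bullet> (?x + t *\<^sub>R y) - b h)" if h: "h \<in> bounding C" for h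
      using bounding(2)[OF C] rep(1)[OF C] h perp[OF h] by (auto simp: inner_add_right)
    then show ?thesis by (subst bounding(2)[OF C]) blast
  qed
  have "a h \<bullet> y = 0" if h: "h \<in> H" for h
  proof (rule ccontr)
    assume nz: "a h \<bullet> y \<noteq> 0"
    define t where "t = (b h - a h \<bullet> ?x) / (a h \<bullet> y)"
    have "a h \<bullet> (?x + t *\<^sub>R y) = b h" using nz by (simp add: t_def inner_add_right)
    then show False using side_nonzero(2)[OF C line h, of t] by simp
  qed
  then have "orthogonal y v" if "v \<in> span (a ` H)" for v
    using that by (intro orthogonal_to_span[of v "a ` H" y]) (auto simp: orthogonal_def inner_commute)
  then have "orthogonal y y" using y(2) by blast
  then show False using y(1) by (simp add: orthogonal_def)
qed

lemma card_bounding_ge: "C \<in> cells H \<Longrightarrow> dim U \<le> card (bounding C)"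
  using span_facet_normals[of C] finite_subset[OF bounding(3) finH]
  by (metis card_image_le dim_le_card' dim_span finite_imageI order_trans)

text \<open>The normals then form a basis of \<open>U\<close>, so one can solve for a direction
  along which every facet inequality improves, and project it into \<open>U\<close>. It is nonzero
  because \<open>H\<close> being nonempty forces a facet.\<close>

lemma free_if_few_facets:
  assumes C: "C \<in> cells H" and few: "card (bounding C) = dim U" and ne: "H \<noteq> {}"
  shows "free C"
proof -
  have finF: "finite (bounding C)" using bounding(3)[OF C] finH by (rule finite_subset)
  have sp: "span (a ` bounding C) = U" by (rule span_facet_normals[OF C])
  have "dim U = dim (a ` bounding C)" using sp by (metis dim_span)
  also have "\<dots> \<le> card (a ` bounding C)" using finF by (intro dim_le_card') simp
  finally have "card (a ` bounding C) = card (bounding C)" using few card_image_le[OF finF, of a] by simp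
  then have inj: "inj_on a (bounding C)" and c: "card (a ` bounding C) = dim U" using eq_card_imp_inj_on[OF finF] few by auto
  have "a ` bounding C \<subseteq> U" using bounding(3)[OF C] a_in_U by blast
  then have ind: "independent (a ` bounding C)"
    by (rule card_le_dim_spanning) (use sp c finF in auto)
  obtain w where w: "\<And>h. h \<in> bounding C \<Longrightarrow> a h \<bullet> w = side (rep C) h"
    using inner_system_solvable[OF inj ind, of "side (rep C)"] by blast
  obtain y where y: "y \<in> U" "\<And>h. h \<in> H \<Longrightarrow> a h \<bullet> y = a h \<bullet> w" using point_in_U[of w] by auto
  have yF: "a h \<bullet> y = side (rep C) h" if "h \<in> bounding C" for h using y(2) w that bounding(3)[OF C] by auto
  obtain h0 where h0: "h0 \<in> H" using ne by blast
  then have "a h0 \<in> U" "a h0 \<noteq> 0" using a_in_U hyp by auto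
  then have "bounding C \<noteq> {}" using sp by auto
  then obtain h where h: "h \<in> bounding C" by blast
  then have "y \<noteq> 0" using yF[OF h] side_nonzero(1)[OF C rep(1)[OF C], of h] bounding(3)[OF C] by auto
  then show ?thesis using yF by (intro freeI[OF C y(1)]) auto
qed

lemma finite_cells: "finite (cells H)"
  and card_cells: "card (cells H) \<le> (card H + 1) ^ dim U"
proof -
  have sub: "rep ` cells H \<subseteq> UNIV - \<Union>H"
    using rep(1) in_components_subset unfolding cells_def by blast
  have inj: "inj_on (\<lambda>C. pos (rep C)) (cells H)"
    by (rule inj_onI) (use cell_cong rep in blast)
  have P: "(\<lambda>C. pos (rep C)) ` cells H = pos ` rep ` cells H" by (simp add: image_image)
  have "pos ` rep ` cells H \<subseteq> Pow H" by (auto simp: pos_def)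
  then have "finite (pos ` rep ` cells H)" using finH by (meson finite_Pow_iff finite_subset)
  then show "finite (cells H)" using inj P by (metis finite_image_iff)
  have "card (cells H) = card (pos ` rep ` cells H)" using card_image[OF inj] P by simp
  also have "\<dots> \<le> (card H + 1) ^ dim U"
    by (rule card_sign_patterns[OF subspace_U order_refl sub]) (use rep(2) subspace_diff[OF subspace_U] in auto)
  finally show "card (cells H) \<le> (card H + 1) ^ dim U" .
qed

text \<open>A free cell contains a ray inside \<open>U\<close>, hence meets one of the \<open>2 * DIM('a)\<close> far away
  sections \<open>{x \<in> U. x \<bullet> i = \<plusminus> R}\<close>, each of which sees only the sign patterns of a space of
  dimension \<open>dim U - 1\<close>.\<close>

lemma card_free_cells:
  assumes ne: "H \<noteq> {}"
  shows "card {C \<in> cells H. free C} \<le> 2 * DIM('a) * (card H + 1) ^ (dim U - 1)"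
proof -
  \<comment> \<open>\<open>R\<close> bounds all coordinates of all representatives, so a ray from a
    representative reaches its section at a parameter t >= 0.\<close>
  define R where "R = (\<Sum>C\<in>cells H. norm (rep C))"
  have R: "\<bar>rep C \<bullet> i\<bar> \<le> R" if "C \<in> cells H" "i \<in> Basis" for C i
  proof -
    have "\<bar>rep C \<bullet> i\<bar> \<le> norm (rep C)" using that Basis_le_norm by blast
    also have "\<dots> \<le> R" unfolding R_def using that finite_cells by (intro member_le_sum) auto
    finally show ?thesis .
  qed
  \<comment> \<open>A vector of \<open>U\<close> with nonzero coordinate at \<open>i\<close> makes
    the section lose a dimension; the ray of a free cell supplies one.\<close>
  define A where "A i \<sigma> = {C \<in> cells H. (\<exists>y\<in>U. y \<bullet> i \<noteq> 0) \<and> (\<exists>p\<in>C \<inter> U. p \<bullet> i = \<sigma> * R)}" for i and \<sigma> :: real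
  have "{C \<in> cells H. free C} \<subseteq> (\<Union>i\<in>Basis. \<Union>\<sigma>\<in>{1, -1}. A i \<sigma>)"
  proof
    fix C assume "C \<in> {C \<in> cells H. free C}"
    then obtain y where C: "C \<in> cells H" and y: "y \<in> U" "y \<noteq> 0" "\<And>x t. x \<in> C \<Longrightarrow> t \<ge> 0 \<Longrightarrow> x + t *\<^sub>R y \<in> C"
      by (auto simp: free_def)
    obtain i where i: "i \<in> Basis" "y \<bullet> i \<noteq> 0" using y(2) by (metis euclidean_all_zero_iff)
    define \<sigma> where "\<sigma> = (if y \<bullet> i > 0 then 1 else -1 :: real)"
    define t where "t = (\<sigma> * R - rep C \<bullet> i) / (y \<bullet> i)"
    have "t \<ge> 0"
      using R[OF C i(1)] i(2) by (cases "y \<bullet> i > 0") (auto simp: t_def \<sigma>_def divide_simps)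
    then have "rep C + t *\<^sub>R y \<in> C \<inter> U"
      using y rep[OF C] subspace_U by (auto simp: subspace_add subspace_scale)
    moreover have "(rep C + t *\<^sub>R y) \<bullet> i = \<sigma> * R" using i by (simp add: t_def inner_add_left)
    ultimately have "C \<in> A i \<sigma>" using C y(1) i(2) unfolding A_def by blast
    then show "C \<in> (\<Union>i\<in>Basis. \<Union>\<sigma>\<in>{1, -1}. A i \<sigma>)" using i(1) by (auto simp: \<sigma>_def split: if_splits)
  qed
  moreover have "finite (\<Union>i\<in>Basis. \<Union>\<sigma>\<in>{1, -1}. A i \<sigma>)"
    using finite_cells by (auto simp: A_def)
  ultimately have "card {C \<in> cells H. free C} \<le> card (\<Union>i\<in>Basis. \<Union>\<sigma>\<in>{1, -1}. A i \<sigma>)"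
    by (rule card_mono[rotated])
  also have "\<dots> \<le> DIM('a) * (2 * (card H + 1) ^ (dim U - 1))"
  proof (intro card_UN_bound)
    fix i :: 'a and \<sigma> :: real
    show "card (A i \<sigma>) \<le> (card H + 1) ^ (dim U - 1)"
    proof (cases "\<exists>y\<in>U. y \<bullet> i \<noteq> 0")
      case True
      define D where "D = {u \<in> U. i \<bullet> u = 0}"
      have subD: "subspace D" unfolding D_def
        using subspace_inter[OF subspace_U subspace_hyperplane[of i]] by (simp add: Int_def)
      have "D \<noteq> U" using True by (auto simp: D_def inner_commute)
      then have "dim D \<noteq> dim U"
        using subspace_dim_equal[OF subD subspace_U] by (auto simp: D_def)
      moreover have "dim D \<le> dim U" by (rule dim_subset) (auto simp: D_def)
      ultimately have dD: "dim D \<le> dim U - 1" by linarith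
      define p where "p C = (SOME p. p \<in> C \<inter> U \<and> p \<bullet> i = \<sigma> * R)" for C
      have p: "p C \<in> C" "p C \<in> U" "p C \<bullet> i = \<sigma> * R" if "C \<in> A i \<sigma>" for C
        using someI_ex[of "\<lambda>p. p \<in> C \<inter> U \<and> p \<bullet> i = \<sigma> * R"] that by (auto simp: A_def p_def)
      have sub: "p ` A i \<sigma> \<subseteq> UNIV - \<Union>H"
        using p(1) in_components_subset unfolding A_def cells_def by blast
      have "inj_on (\<lambda>C. pos (p C)) (A i \<sigma>)"
      proof (rule inj_onI)
        fix C C' assume "C \<in> A i \<sigma>" "C' \<in> A i \<sigma>" "pos (p C) = pos (p C')"
        then show "C = C'" using cell_cong[of C C' "p C" "p C'"] p(1) by (auto simp: A_def)
      qed
      then have "card (A i \<sigma>) = card (pos ` p ` A i \<sigma>)"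
        using card_image by (metis (no_types, lifting) image_cong image_image)
      also have "\<dots> \<le> (card H + 1) ^ (dim U - 1)"
      proof (rule card_sign_patterns[OF subD dD sub])
        fix y y' assume "y \<in> p ` A i \<sigma>" "y' \<in> p ` A i \<sigma>"
        then show "y - y' \<in> D"
          using p(2,3) subspace_diff[OF subspace_U] by (auto simp: D_def inner_diff_right inner_commute)
      qed
      finally show ?thesis .
    next
      case False
      then have "A i \<sigma> = {}" by (auto simp: A_def)
      then show ?thesis by simp
    qed
  qed auto
  finally show ?thesis by (simp add: mult_ac)
qed

section \<open>Simplicial cells and their codegree\<close>

definition simplex_cells :: "'a set set" where
  "simplex_cells = {C \<in> cells H. \<not> free C \<and> card (bounding C) = DIM('a) + 1}"

text \<open>If these normals did not span, a vector orthogonal to them, with sign chosen to suit the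
  one remaining facet, would make the cell free. So they form a basis and their hyperplanes meet in
  a point.\<close>

lemma facets_minus_one_independent:
  assumes full: "U = UNIV" and C: "C \<in> simplex_cells" and T: "T \<subseteq> bounding C" "card T = DIM('a)"
  shows "\<exists>w. \<forall>h\<in>T. a h \<bullet> w = b h"
    and "\<exists>g. bounding C = insert g T"
proof -
  have CC: "C \<in> cells H" and nf: "\<not> free C" and c: "card (bounding C) = DIM('a) + 1"
    using C by (auto simp: simplex_cells_def)
  have finF: "finite (bounding C)" using c by (simp add: card_ge_0_finite)
  have finT: "finite T" using T(1) finF by (rule finite_subset)
  have "card (bounding C - T) = 1" using T c finT by (simp add: card_Diff_subset)
  then obtain g where g: "bounding C - T = {g}" by (auto simp: card_1_singleton_iff)
  then have FC: "bounding C = insert g T" using T by blast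
  then show "\<exists>g. bounding C = insert g T" by blast
  have "span (a ` T) = UNIV"
  proof (rule ccontr)
    assume "span (a ` T) \<noteq> UNIV"
    then have "span (a ` T) \<subset> span (UNIV :: 'a set)" by auto
    then obtain y where y: "y \<noteq> 0" "\<And>v. v \<in> span (a ` T) \<Longrightarrow> orthogonal y v"
      using orthogonal_to_subspace_exists_gen by metis
    have perp: "a h \<bullet> y = 0" if "h \<in> T" for h
      using y(2)[of "a h"] that by (auto simp: span_base orthogonal_def inner_commute)
    define z where "z = (if side (rep C) g * (a g \<bullet> y) \<ge> 0 then y else - y)"
    have "free C"
    proof (rule freeI[OF CC])
      show "z \<in> U" "z \<noteq> 0" using full y by (auto simp: z_def)
      fix h assume "h \<in> bounding C"
      then show "0 \<le> side (rep C) h * (a h \<bullet> z)" using perp FC by (auto simp: z_def)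
    qed
    then show False using nf by blast
  qed
  then have "DIM('a) \<le> card (a ` T)"
    using dim_le_card'[of "a ` T"] finT by (metis dim_UNIV dim_span finite_imageI)
  then have card: "card (a ` T) = DIM('a)" using card_image_le[OF finT, of a] T by simp
  then have inj: "inj_on a T" using eq_card_imp_inj_on[OF finT] T by simp
  have "independent (a ` T)"
    by (rule card_le_dim_spanning[of _ UNIV]) (use \<open>span (a ` T) = UNIV\<close> finT card in auto)
  from inner_system_solvable[OF inj this] show "\<exists>w. \<forall>h\<in>T. a h \<bullet> w = b h" by blast
qed

text \<open>A direction strictly inside all half-spaces of \<open>T\<close> must leave through
  \<open>g\<close>, else the cell would be free. Applied to \<open>rep C - w\<close>, this puts the
  vertex \<open>w\<close> strictly on the cell's side of \<open>g\<close>, so short steps from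
  \<open>w\<close> into the cone of \<open>T\<close> stay in the cell.\<close>

lemma simplex_cell_near_vertex:
  assumes full: "U = UNIV" and C: "C \<in> simplex_cells" and T: "bounding C = insert g T" "T \<noteq> {}"
    and w: "\<And>h. h \<in> T \<Longrightarrow> a h \<bullet> w = b h" and z: "\<And>h. h \<in> T \<Longrightarrow> 0 < side (rep C) h * (a h \<bullet> z)"
  shows "\<exists>\<epsilon>>0. \<forall>t. 0 < t \<and> t < \<epsilon> \<longrightarrow> w + t *\<^sub>R z \<in> C"
proof -
  let ?s = "side (rep C)"
  have CC: "C \<in> cells H" and nf: "\<not> free C" using C by (auto simp: simplex_cells_def)
  have neg: "?s g * (a g \<bullet> y) < 0" if y: "\<And>h. h \<in> T \<Longrightarrow> 0 < ?s h * (a h \<bullet> y)" for y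
  proof (rule ccontr)
    assume nn: "\<not> ?thesis"
    have "free C"
    proof (rule freeI[OF CC])
      show "y \<in> U" using full by simp
      show "y \<noteq> 0" using y T(2) by force
      fix h assume "h \<in> bounding C"
      then show "0 \<le> ?s h * (a h \<bullet> y)" using y nn T by (auto intro: less_imp_le)
    qed
    then show False using nf by blast
  qed
  define x where "x = rep C"
  have x: "0 < ?s h * (a h \<bullet> x - b h)" if "h \<in> bounding C" for h
    using bounding(2)[OF CC] rep(1)[OF CC] that by (auto simp: x_def)
  define \<gamma> where "\<gamma> = ?s g * (a g \<bullet> w - b g)"
  have "?s g * (a g \<bullet> (x - w)) < 0"
    by (rule neg) (use x T w in \<open>auto simp: inner_diff_right\<close>)
  moreover have "0 < ?s g * (a g \<bullet> x - b g)" using x T by auto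
  ultimately have \<gamma>: "\<gamma> > 0" by (simp add: \<gamma>_def inner_diff_right algebra_simps)
  define \<delta> where "\<delta> = - (?s g * (a g \<bullet> z))"
  have \<delta>: "\<delta> > 0" using neg[OF z] by (simp add: \<delta>_def)
  have "w + t *\<^sub>R z \<in> C" if t: "0 < t" "t < \<gamma> / \<delta>" for t
  proof -
    have "0 < ?s h * (a h \<bullet> (w + t *\<^sub>R z) - b h)" if h: "h \<in> bounding C" for h
    proof (cases "h \<in> T")
      case True
      then have "?s h * (a h \<bullet> (w + t *\<^sub>R z) - b h) = t * (?s h * (a h \<bullet> z))"
        using w by (simp add: inner_add_right)
      also have "\<dots> > 0" using t(1) z[OF True] by (rule mult_pos_pos)
      finally show ?thesis .
    next
      case False
      then have "h = g" using h T by auto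
      then have "?s h * (a h \<bullet> (w + t *\<^sub>R z) - b h) = \<gamma> - t * \<delta>"
        by (simp add: \<gamma>_def \<delta>_def inner_add_right algebra_simps)
      also have "\<dots> > 0" using t \<delta> by (simp add: field_simps)
      finally show ?thesis .
    qed
    then show ?thesis by (subst bounding(2)[OF CC]) blast
  qed
  moreover have "\<gamma> / \<delta> > 0" using \<gamma> \<delta> by simp
  ultimately show ?thesis by blast
qed

text \<open>Two such cells with equal signs on \<open>T\<close> share points near the common vertex
  and therefore coincide, which leaves at most one cell per subset of \<open>T\<close>.\<close>

lemma simplex_codegree:
  assumes full: "U = UNIV" and T: "T \<subseteq> H" "card T = DIM('a)"
  shows "card {e \<in> bounding ` simplex_cells. T \<subseteq> e} \<le> 2 ^ DIM('a)"
proof -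
  let ?Q = "{C \<in> simplex_cells. T \<subseteq> bounding C}"
  have finT: "finite T" using T(1) finH by (rule finite_subset)
  have Tne: "T \<noteq> {}" using T(2) DIM_positive[where 'a='a] by auto
  have finQ: "finite ?Q" using finite_cells by (simp add: simplex_cells_def)
  have "inj_on (\<lambda>C. pos (rep C) \<inter> T) ?Q"
  proof (rule inj_onI)
    fix C C' assume C: "C \<in> ?Q" and C': "C' \<in> ?Q" and eq: "pos (rep C) \<inter> T = pos (rep C') \<inter> T"
    have CS: "C \<in> simplex_cells" "C' \<in> simplex_cells" and TF: "T \<subseteq> bounding C" "T \<subseteq> bounding C'" using C C' by auto
    have cells: "C \<in> cells H" "C' \<in> cells H" using CS by (auto simp: simplex_cells_def)
    obtain w where w: "\<And>h. h \<in> T \<Longrightarrow> a h \<bullet> w = b h"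
      using facets_minus_one_independent(1)[OF full CS(1) TF(1) T(2)] by blast
    obtain g g' where g: "bounding C = insert g T" "bounding C' = insert g' T"
      using facets_minus_one_independent(2)[OF full CS(1) TF(1) T(2)]
        facets_minus_one_independent(2)[OF full CS(2) TF(2) T(2)] by blast
    have seq: "side (rep C') h = side (rep C) h" if h: "h \<in> T" for h
    proof -
      have hH: "h \<in> H" using h T by blast
      have "h \<in> pos (rep C) \<longleftrightarrow> h \<in> pos (rep C')" using eq h by blast
      moreover have "a h \<bullet> rep C \<noteq> b h" "a h \<bullet> rep C' \<noteq> b h"
        using side_nonzero(2)[OF cells(1) rep(1)[OF cells(1)] hH]
          side_nonzero(2)[OF cells(2) rep(1)[OF cells(2)] hH] by auto
      ultimately show ?thesis using hH by (auto simp: pos_def side_def sgn_if)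
    qed
    define z where "z = rep C - w"
    have z: "0 < side (rep C) h * (a h \<bullet> z)" if h: "h \<in> T" for h
      using side_nonzero(2)[OF cells(1) rep(1)[OF cells(1)], of h] w[OF h] h T(1) by (auto simp: z_def inner_diff_right)
    obtain \<epsilon> where e: "\<epsilon> > 0" "\<And>t. 0 < t \<and> t < \<epsilon> \<Longrightarrow> w + t *\<^sub>R z \<in> C"
      using simplex_cell_near_vertex[OF full CS(1) g(1) Tne w z] by blast
    obtain \<epsilon>' where e': "\<epsilon>' > 0" "\<And>t. 0 < t \<and> t < \<epsilon>' \<Longrightarrow> w + t *\<^sub>R z \<in> C'"
      using simplex_cell_near_vertex[OF full CS(2) g(2) Tne w, of z] z seq by auto
    define t where "t = min \<epsilon> \<epsilon>' / 2"
    have t: "0 < t" "t < \<epsilon>" "t < \<epsilon>'" using e(1) e'(1) by (auto simp: t_def min_def)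
    then have "w + t *\<^sub>R z \<in> C" "w + t *\<^sub>R z \<in> C'" using e(2) e'(2) by auto
    then show "C = C'" using cell_cong[OF cells] by blast
  qed
  then have "card ?Q \<le> card (Pow T)"
    using finT by (intro card_inj_on_le[of "\<lambda>C. pos (rep C) \<inter> T"]) auto
  moreover have "{e \<in> bounding ` simplex_cells. T \<subseteq> e} = bounding ` ?Q" by blast
  ultimately show ?thesis using card_image_le[OF finQ, of bounding] T finT by (simp add: card_Pow)
qed

section \<open>Certificates for all hyperedges\<close>

definition subcollection :: "nat \<Rightarrow> 'a set \<Rightarrow> 'a set set" where
  "subcollection j C = (SOME G. G \<subseteq> bounding C \<and> card G = j)"

lemma subcollection:
  assumes "j \<le> card (bounding C)"
  shows "subcollection j C \<subseteq> bounding C" "card (subcollection j C) = j"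
proof -
  have "\<exists>G. G \<subseteq> bounding C \<and> card G = j" using obtain_subset_with_card_n[OF assms] by metis
  from someI_ex[OF this] show "subcollection j C \<subseteq> bounding C" "card (subcollection j C) = j"
    by (auto simp: subcollection_def)
qed

text \<open>Facet sets are trimmed to one size j, as \<open>light\<close> demands. For order n^i
  cells the excess k = j - i makes the family light; passing from (n + 1)^i to n^i costs
  2^d.\<close>

lemma light_subcollections:
  assumes Q: "Q \<subseteq> cells H" "\<And>C. C \<in> Q \<Longrightarrow> j \<le> card (bounding C)" and cQ: "card Q \<le> M * (card H + 1) ^ i"
    and H: "H \<noteq> {}" and j: "1 \<le> j" "j \<le> k * r" "k \<le> 3" "j = i + k" and i: "i \<le> d" and K: "M * 2 ^ d \<le> K"
  shows "light (card H) r K (subcollection j ` Q)"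
proof -
  let ?n = "card H"
  have n: "1 \<le> ?n" using H finH by (simp add: Suc_leI card_gt_0_iff)
  have finQ: "finite Q" using Q(1) finite_cells by (rule finite_subset)
  have "card (subcollection j ` Q) \<le> M * (?n + 1) ^ i" using card_image_le[OF finQ, of "subcollection j"] cQ by linarith
  also have "\<dots> \<le> M * (2 * ?n) ^ i" using n by (intro mult_left_mono power_mono) auto
  also have "\<dots> = (M * 2 ^ i) * ?n ^ i" by (simp add: power_mult_distrib)
  also have "\<dots> \<le> (M * 2 ^ d) * ?n ^ i" using i by (intro mult_right_mono mult_left_mono power_increasing) auto
  also have "\<dots> \<le> K * ?n ^ i" using K by (intro mult_right_mono) auto
  finally have "card (subcollection j ` Q) * ?n ^ k \<le> K * ?n ^ i * ?n ^ k" by (intro mult_right_mono) auto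
  also have "\<dots> = K * ?n ^ j" using j(4) by (simp add: power_add)
  finally have "card (subcollection j ` Q) * ?n ^ k \<le> K * ?n ^ j" .
  moreover have "\<forall>b\<in>subcollection j ` Q. card b = j" using subcollection(2) Q(2) by blast
  ultimately show ?thesis unfolding light_def using j(1-3) by blast
qed

text \<open>\<open>K\<close> combines the factor 2 d of \<open>card_free_cells\<close> with the 2^d
  lost from n + 1 to n, and also covers the codegree 2^d. Free cells have at least dim U facets and
  number order n^(dim U - 1), so k = 1.\<close>

lemma certificate_families:
  assumes d: "DIM('a) \<ge> 2" and H: "H \<noteq> {}"
  defines "K \<equiv> 2 * DIM('a) * 2 ^ DIM('a)"
  shows "\<exists>E B1 B2. bounded_codegree DIM('a) K H E \<and> B1 \<subseteq> Pow H \<and> B2 \<subseteq> Pow H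
    \<and> light (card H) DIM('a) K B1 \<and> light (card H) DIM('a) K B2
    \<and> (\<forall>C\<in>cells H. \<exists>e\<in>E \<union> B1 \<union> B2. e \<subseteq> facet_hyperplanes H C)"
proof -
  let ?d = "DIM('a)" and ?\<rho> = "dim U"
  let ?free = "{C \<in> cells H. free C}"
  define B1 where "B1 = subcollection ?\<rho> ` ?free"
  have \<rho>d: "?\<rho> \<le> ?d" by (rule dim_subset_UNIV)
  obtain h0 where "h0 \<in> H" using H by blast
  then have "a h0 \<in> U" "a h0 \<noteq> 0" using a_in_U hyp by auto
  then have \<rho>1: "1 \<le> ?\<rho>" using dim_eq_0[of U] by (metis One_nat_def Suc_leI bot_nat_0.not_eq_extremum singletonD subsetD)
  have subV: "subcollection j C \<in> Pow H" if "C \<in> cells H" "j \<le> card (bounding C)" for j C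
    using subcollection(1)[OF that(2)] bounding(3)[OF that(1)] by auto
  have B1V: "B1 \<subseteq> Pow H" using subV card_bounding_ge by (auto simp: B1_def)
  have light1: "light (card H) ?d K B1"
    unfolding B1_def
  proof (rule light_subcollections[where i = "?\<rho> - 1" and k = 1 and d = "?d" and M = "2 * ?d"])
    show "card ?free \<le> 2 * ?d * (card H + 1) ^ (?\<rho> - 1)" by (rule card_free_cells[OF H])
  qed (use H \<rho>1 \<rho>d card_bounding_ge in \<open>auto simp: K_def\<close>)
  have cert1: "\<exists>e\<in>B1. e \<subseteq> facet_hyperplanes H C" if "C \<in> cells H" "free C" for C
    using that subcollection(1)[OF card_bounding_ge[OF that(1)]] bounding(1)[OF that(1)] unfolding B1_def by blast
  have nonfree: "?\<rho> + 1 \<le> card (bounding C)" if "C \<in> cells H" "\<not> free C" for C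
    using card_bounding_ge[OF that(1)] free_if_few_facets[OF that(1) _ H] that(2) by (metis Suc_eq_plus1 Suc_leI le_neq_implies_less)
  have K1: "1 * 2 ^ ?d \<le> K" unfolding K_def using d by (intro mult_right_mono) auto
  show ?thesis
  proof (cases "?\<rho> < ?d")
    \<comment> \<open>Rank below d: order n^(dim U) non-free cells, each trimmed to dim U + 1 <= d
      facets, are light with k = 1, and the codegree hypergraph can be empty.\<close>
    case True
    let ?Q = "{C \<in> cells H. \<not> free C}"
    define B2 where "B2 = subcollection (?\<rho> + 1) ` ?Q"
    have "card ?Q \<le> card (cells H)" using finite_cells by (intro card_mono) auto
    then have cQ: "card ?Q \<le> 1 * (card H + 1) ^ ?\<rho>" using card_cells by linarith
    have light2: "light (card H) ?d K B2"
      unfolding B2_def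
      by (rule light_subcollections[where i = "?\<rho>" and k = 1 and d = "?d", OF _ _ cQ H])
         (use True nonfree K1 in auto)
    have B2V: "B2 \<subseteq> Pow H" using subV nonfree by (auto simp: B2_def)
    have codeg: "bounded_codegree ?d K H {}" by (simp add: bounded_codegree_def)
    have cert2: "\<exists>e\<in>B2. e \<subseteq> facet_hyperplanes H C" if "C \<in> cells H" "\<not> free C" for C
      using that subcollection(1)[OF nonfree[OF that]] bounding(1)[OF that(1)] unfolding B2_def by blast
    have cert: "\<forall>C\<in>cells H. \<exists>e\<in>{} \<union> B1 \<union> B2. e \<subseteq> facet_hyperplanes H C"
    proof
      fix C assume C: "C \<in> cells H"
      show "\<exists>e\<in>{} \<union> B1 \<union> B2. e \<subseteq> facet_hyperplanes H C"
      proof (cases "free C")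
        case True
        from cert1[OF C True] show ?thesis by blast
      next
        case False
        from cert2[OF C False] show ?thesis by blast
      qed
    qed
    show ?thesis
      by (rule exI[of _ "{}"], rule exI[of _ B1], rule exI[of _ B2])
         (intro conjI codeg B1V B2V light1 light2 cert)
  next
    \<comment> \<open>At full rank d + 1 facets exceed the limit j <= d for k = 1, so simplices need
      the codegree bound; cells with d + 2 facets or more are light with k = 2, as d + 2 <= 2
      d.\<close>
    case False
    then have full: "?\<rho> = ?d" using \<rho>d by simp
    then have UNIV: "U = UNIV" by (metis U_def dim_eq_full dim_span span_span)
    let ?Q = "{C \<in> cells H. \<not> free C \<and> ?d + 2 \<le> card (bounding C)}"
    define B2 where "B2 = subcollection (?d + 2) ` ?Q"
    have "card ?Q \<le> card (cells H)" using finite_cells by (intro card_mono) auto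
    then have cQ: "card ?Q \<le> 1 * (card H + 1) ^ ?d" using card_cells full by simp
    have light2: "light (card H) ?d K B2"
      unfolding B2_def
      by (rule light_subcollections[where i = "?d" and k = 2 and d = "?d", OF _ _ cQ H])
         (use d K1 in auto)
    have B2V: "B2 \<subseteq> Pow H" using subV by (auto simp: B2_def)
    have codeg: "bounded_codegree ?d K H (bounding ` simplex_cells)"
      unfolding bounded_codegree_def
    proof (intro conjI ballI allI impI)
      fix e assume "e \<in> bounding ` simplex_cells"
      then show "e \<subseteq> H" "card e = ?d + 1" using bounding(3) by (auto simp: simplex_cells_def)
    next
      fix T assume "T \<subseteq> H \<and> card T = ?d"
      then show "card {e \<in> bounding ` simplex_cells. T \<subseteq> e} \<le> K" using simplex_codegree[OF UNIV, of T] K1 by linarith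
    qed
    have cert2: "\<exists>e\<in>bounding ` simplex_cells \<union> B2. e \<subseteq> facet_hyperplanes H C"
      if C: "C \<in> cells H" "\<not> free C" for C
    proof (cases "card (bounding C) = ?d + 1")
      case True
      then show ?thesis using C bounding(1)[OF C(1)] by (intro bexI[of _ "bounding C"]) (auto simp: simplex_cells_def)
    next
      case False
      then have ge: "?d + 2 \<le> card (bounding C)" using nonfree[OF C] full by linarith
      then show ?thesis using C subcollection(1)[OF ge] bounding(1)[OF C(1)] unfolding B2_def by blast
    qed
    have cert: "\<forall>C\<in>cells H. \<exists>e\<in>bounding ` simplex_cells \<union> B1 \<union> B2. e \<subseteq> facet_hyperplanes H C"
    proof
      fix C assume C: "C \<in> cells H"
      show "\<exists>e\<in>bounding ` simplex_cells \<union> B1 \<union> B2. e \<subseteq> facet_hyperplanes H C"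
      proof (cases "free C")
        case True
        from cert1[OF C True] show ?thesis by blast
      next
        case False
        from cert2[OF C False] show ?thesis by blast
      qed
    qed
    show ?thesis
      by (rule exI[of _ "bounding ` simplex_cells"], rule exI[of _ B1], rule exI[of _ B2])
         (intro conjI codeg B1V B2V light1 light2 cert)
  qed
qed

end

section \<open>From arrangements to beta\<close>

lemma hyperplanes_arrangement:
  assumes "finite H" "\<And>h. h \<in> H \<Longrightarrow> hyperplane h"
  obtains a b where "arrangement H a b"
proof -
  have "\<exists>a b. h \<in> H \<longrightarrow> a \<noteq> 0 \<and> h = {x. a \<bullet> x = b}" for h
    using assms(2)[of h] by (auto simp: hyperplane_def)
  then obtain a b where "\<And>h. h \<in> H \<Longrightarrow> a h \<noteq> 0 \<and> h = {x. a h \<bullet> x = b h}" by metis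
  then have "arrangement H a b" by (rule arrangement.intro[OF assms(1)])
  then show ?thesis by (rule that)
qed

lemma independent_hyperplanes:
  assumes d: "DIM('a::euclidean_space) \<ge> 2"
  shows "\<exists>c>0. \<forall>\<^sub>F n in sequentially. \<forall>H :: 'a set set. hyperplane_family n H \<longrightarrow>
    (\<exists>S. independent_in (arrangement_hypergraph H) S \<and>
      real (card S) \<ge> c * (real n * ln (real n)) powr (1 / real DIM('a)))"
proof -
  let ?K = "2 * DIM('a) * 2 ^ DIM('a)"
  obtain c where c: "c > 0" and ev: "\<forall>\<^sub>F n in sequentially. \<forall>(V :: 'a set set) E B1 B2.
    finite V \<and> card V = n \<and> bounded_codegree DIM('a) ?K V E \<and> B1 \<subseteq> Pow V \<and> B2 \<subseteq> Pow V
      \<and> light n DIM('a) ?K B1 \<and> light n DIM('a) ?K B2 \<longrightarrow>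
    (\<exists>S\<subseteq>V. (\<forall>e\<in>E \<union> B1 \<union> B2. \<not> e \<subseteq> S) \<and> c * (real n * ln (real n)) powr (1 / real DIM('a)) \<le> real (card S))"
    using independent_set_bounded_codegree[OF d, of ?K, where 'a = "'a set"] by auto
  have "\<forall>\<^sub>F n in sequentially. \<forall>H :: 'a set set. hyperplane_family n H \<longrightarrow>
    (\<exists>S. independent_in (arrangement_hypergraph H) S \<and>
      real (card S) \<ge> c * (real n * ln (real n)) powr (1 / real DIM('a)))"
    using ev eventually_ge_at_top[of 1]
  proof eventually_elim
    case (elim n)
    show ?case
    proof (intro allI impI)
      fix H :: "'a set set" assume "hyperplane_family n H"
      then have H: "finite H" "card H = n" "\<And>h. h \<in> H \<Longrightarrow> hyperplane h" by (auto simp: hyperplane_family_def)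
      obtain a b where "arrangement H a b" using hyperplanes_arrangement[OF H(1,3)] by blast
      then interpret arrangement H a b .
      have "H \<noteq> {}" using H elim(2) by auto
      from certificate_families[OF d this, unfolded H(2)] obtain E B1 B2
        where fam: "bounded_codegree DIM('a) ?K H E \<and> B1 \<subseteq> Pow H \<and> B2 \<subseteq> Pow H
          \<and> light n DIM('a) ?K B1 \<and> light n DIM('a) ?K B2
          \<and> (\<forall>C\<in>cells H. \<exists>e\<in>E \<union> B1 \<union> B2. e \<subseteq> facet_hyperplanes H C)"
        by (elim exE)
      from fam have cert: "\<And>C. C \<in> cells H \<Longrightarrow> \<exists>e\<in>E \<union> B1 \<union> B2. e \<subseteq> facet_hyperplanes H C" by simp
      have "\<exists>S\<subseteq>H. (\<forall>e\<in>E \<union> B1 \<union> B2. \<not> e \<subseteq> S)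
          \<and> c * (real n * ln (real n)) powr (1 / real DIM('a)) \<le> real (card S)"
        by (rule elim(1)[rule_format]) (use fam H(1,2) in simp)
      then obtain S where S: "S \<subseteq> H" "\<forall>e\<in>E \<union> B1 \<union> B2. \<not> e \<subseteq> S"
        "c * (real n * ln (real n)) powr (1 / real DIM('a)) \<le> real (card S)"
        by (elim exE conjE)
      have "independent_in (arrangement_hypergraph H) S"
        unfolding independent_in_def arrangement_hypergraph_def fst_conv snd_conv
      proof (intro conjI ballI S(1))
        fix e assume "e \<in> facet_hyperplanes H ` cells H"
        then obtain C where C: "C \<in> cells H" "e = facet_hyperplanes H C" by (rule imageE)
        from cert[OF C(1)] obtain f where "f \<in> E \<union> B1 \<union> B2" "f \<subseteq> e" unfolding C(2) by (rule bexE)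
        then show "\<not> e \<subseteq> S" using S(2) by (meson order_trans)
      qed
      then show "\<exists>S. independent_in (arrangement_hypergraph H) S \<and>
          real (card S) \<ge> c * (real n * ln (real n)) powr (1 / real DIM('a))"
        using S(3) by blast
    qed
  qed
  with c show ?thesis by blast
qed

text \<open>Parallel hyperplanes show that the infimum defining \<open>beta\<close> ranges over a
  nonempty set, hence is attained.\<close>

lemma hyperplane_family_exists: "\<exists>H :: 'a::euclidean_space set set. hyperplane_family n H"
proof -
  obtain v :: 'a where v: "v \<in> Basis" using nonempty_Basis by blast
  define h where "h i = {x. v \<bullet> x = real i}" for i
  have "inj h"
  proof (rule injI)
    fix i j assume "h i = h j"
    moreover have "real i *\<^sub>R v \<in> h i" using v by (simp add: h_def)
    ultimately have "real i *\<^sub>R v \<in> h j" by simp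
    then show "i = j" using v by (simp add: h_def)
  qed
  then have "card (h ` {..<n}) = n" by (simp add: card_image inj_on_subset)
  moreover have "hyperplane (h i)" for i using v nonzero_Basis by (auto simp: hyperplane_def h_def)
  ultimately show ?thesis by (intro exI[of _ "h ` {..<n}"]) (auto simp: hyperplane_family_def)
qed

lemma beta_ge:
  fixes x :: real
  assumes "\<And>H :: 'a::euclidean_space set set. hyperplane_family n H \<Longrightarrow>
    \<exists>S. independent_in (arrangement_hypergraph H) S \<and> x \<le> real (card S)"
  shows "x \<le> real (beta TYPE('a) n)"
proof -
  let ?B = "{beta_arr H | H :: 'a set set. hyperplane_family n H}"
  have "?B \<noteq> {}" using hyperplane_family_exists by auto
  then have "Inf ?B \<in> ?B" by (rule Inf_nat_def1)
  then obtain H :: "'a set set" where H: "hyperplane_family n H" "beta TYPE('a) n = beta_arr H"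
    unfolding beta_def by auto
  obtain S where S: "independent_in (arrangement_hypergraph H) S" "x \<le> real (card S)" using assms[OF H(1)] by blast
  have "finite H" using H(1) by (simp add: hyperplane_family_def)
  then have "finite {S. independent_in (arrangement_hypergraph H) S}"
    by (rule finite_subset[rotated, OF finite_Pow_iff[THEN iffD2]])
       (auto simp: independent_in_def arrangement_hypergraph_def)
  then have "finite {card S | S. independent_in (arrangement_hypergraph H) S}" by simp
  then have "card S \<le> beta_arr H" unfolding beta_arr_def using S(1) by (intro Max_ge) auto
  then show ?thesis using S(2) H(2) by simp
qed

theorem theorem8:
  assumes "CARD('d::finite) \<ge> 2"
  shows "(\<lambda>n. real (beta TYPE(real ^ 'd) n))
           \<in> \<Omega>(\<lambda>n. (real n * ln (real n)) powr (1 / real CARD('d)))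
       \<and> (\<exists>c>0. \<forall>\<^sub>F n in sequentially. \<forall>H :: (real ^ 'd) set set. hyperplane_family n H \<longrightarrow>
            (\<exists>S. independent_in (arrangement_hypergraph H) S \<and>
                 real (card S) \<ge> c * (real n * ln (real n)) powr (1 / real CARD('d))))"
proof -
  obtain c where c: "c > 0" and ev: "\<forall>\<^sub>F n in sequentially. \<forall>H :: (real ^ 'd) set set. hyperplane_family n H \<longrightarrow>
    (\<exists>S. independent_in (arrangement_hypergraph H) S \<and>
      real (card S) \<ge> c * (real n * ln (real n)) powr (1 / real CARD('d)))"
    using independent_hyperplanes[where 'a = "real ^ 'd"] assms by auto
  have "\<forall>\<^sub>F n in sequentially. c * norm ((real n * ln (real n)) powr (1 / real CARD('d)))
      \<le> norm (real (beta TYPE(real ^ 'd) n))"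
    using ev
  proof eventually_elim
    case (elim n)
    then have "c * (real n * ln (real n)) powr (1 / real CARD('d)) \<le> real (beta TYPE(real ^ 'd) n)"
      by (intro beta_ge) auto
    then show ?case by simp
  qed
  then have "(\<lambda>n. real (beta TYPE(real ^ 'd) n)) \<in> \<Omega>(\<lambda>n. (real n * ln (real n)) powr (1 / real CARD('d)))"
    by (rule landau_omega.bigI[OF c])
  with c ev show ?thesis by blast
qed

end
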